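(* Let a group $G$ act without inversion on a tree $\widetilde{\Gamma}$, and suppose the quotient graph $\Gamma = G\backslash\widetilde{\Gamma}$ is a segment. Let a lift of $\Gamma$ in $\widetilde{\Gamma}$ have vertices $P$, $Q$ and edge $y$. Suppose there are subgroups $G_P$, $G_Q$, $G_y$, $H$ of $G$ with $G_y\le G_P$ and $G_y\le G_Q$ such that the stabilizers in $G$ of $P$, $Q$ and $y$ are the internal semidirect products $G_P\rtimes H$, $G_Q\rtimes H$ and $G_y\rtimes H$ respectively. Then $$G\;\simeq\;(G_P *_{G_y} G_Q)\rtimes H.$$
   Context: Here $G_P$, $G_Q$, $G_y$ denote the normal factors of the stabilizers, not the stabilizers themselves. A subgroup $S\le G$ is the internal semidirect product $K\rtimes H$ of subgroups $K,H$ if $K$ is normal in $S$, $S=KH$ and $K\cap H=1$. A segment is a graph consisting of two distinct vertices joined by a single (geometric) edge. An action on a tree is without inversion if no group element maps an oriented edge to its reverse. A lift of $\Gamma$ is a subgraph of $\widetilde{\Gamma}$ mapped isomorphically onto $\Gamma$ by the quotient map. $G_P *_{G_y} G_Q$ is the free product of $G_P$ and $G_Q$ amalgamated along $G_y$ via the inclusions. The action of $H$ on $G_P *_{G_y} G_Q$ defining the semidirect product is the unique one restricting to conjugation by elements of $H$ on $G_P$ and on $G_Q$; the amalgam is the normal factor. *)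

theory Defs
  imports
    "HOL-Algebra.Group_Action"
    "Graph_Theory.Bidirected_Digraph"
    "Graph_Theory.Digraph_Component"
begin

section \<open>Graphs and trees\<close>

text \<open>
  A graph in the sense of Serre is a \<^locale>\<open>bidirected_digraph\<close>: \<open>arcs\<close> are the oriented edges and
  \<open>arev\<close> is the fixed point free reversal (extended by the identity outside \<open>arcs\<close>). A geometric
  edge is a pair \<open>{a, arev a}\<close>. Loops and multiple edges are allowed.
\<close>

text \<open>
  The walk \<open>[a, arev a]\<close> is a \<^term>\<open>pre_digraph.cycle\<close>, so circuits are cycles without backtracking.
  (A cycle has pairwise distinct vertices, hence only the consecutive pairs have to be examined;
  a loop is a circuit of length 1, two parallel edges give a circuit of length 2.)
\<close>

definition circuit :: "('v, 'e) pre_digraph \<Rightarrow> ('e \<Rightarrow> 'e) \<Rightarrow> 'e list \<Rightarrow> bool" where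
  "circuit \<Gamma> arev p \<longleftrightarrow>
     pre_digraph.cycle \<Gamma> p \<and> (\<forall>i. Suc i < length p \<longrightarrow> p ! Suc i \<noteq> arev (p ! i))"

definition graph_tree :: "('v, 'e) pre_digraph \<Rightarrow> ('e \<Rightarrow> 'e) \<Rightarrow> bool" where
  "graph_tree \<Gamma> arev \<longleftrightarrow>
     bidirected_digraph \<Gamma> arev \<and> connected \<Gamma> \<and> (\<nexists>p. circuit \<Gamma> arev p)"

definition segment :: "('v, 'e) pre_digraph \<Rightarrow> ('e \<Rightarrow> 'e) \<Rightarrow> bool" where
  "segment \<Gamma> arev \<longleftrightarrow>
     bidirected_digraph \<Gamma> arev \<and>
     (\<exists>u v a. u \<noteq> v \<and> verts \<Gamma> = {u, v} \<and> arcs \<Gamma> = {a, arev a} \<and> tail \<Gamma> a = u \<and> head \<Gamma> a = v)"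


section \<open>Groups acting on graphs\<close>

locale graph_action =
  bidirected_digraph \<Gamma> arev +
  vertex_action: group_action G "verts \<Gamma>" \<phi>V +
  arc_action: group_action G "arcs \<Gamma>" \<phi>E
  for G :: "('g, 'm) monoid_scheme" and \<Gamma> :: "('v, 'e) pre_digraph" and arev \<phi>V \<phi>E +
  assumes tail_action: "g \<in> carrier G \<Longrightarrow> a \<in> arcs \<Gamma> \<Longrightarrow> tail \<Gamma> (\<phi>E g a) = \<phi>V g (tail \<Gamma> a)"
    and head_action: "g \<in> carrier G \<Longrightarrow> a \<in> arcs \<Gamma> \<Longrightarrow> head \<Gamma> (\<phi>E g a) = \<phi>V g (head \<Gamma> a)"
    and arev_action: "g \<in> carrier G \<Longrightarrow> a \<in> arcs \<Gamma> \<Longrightarrow> \<phi>E g (arev a) = arev (\<phi>E g a)"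

definition without_inversion ::
  "('g, 'm) monoid_scheme \<Rightarrow> ('v, 'e) pre_digraph \<Rightarrow> ('e \<Rightarrow> 'e) \<Rightarrow> ('g \<Rightarrow> 'e \<Rightarrow> 'e) \<Rightarrow> bool" where
  "without_inversion G \<Gamma> arev \<phi>E \<longleftrightarrow> (\<forall>g \<in> carrier G. \<forall>a \<in> arcs \<Gamma>. \<phi>E g a \<noteq> arev a)"

text \<open>
  Vertices and oriented edges of the quotient are orbits. By equivariance the image of the orbit of
  \<open>a\<close> under \<open>tail\<close>, \<open>head\<close>, \<open>arev\<close> is the orbit of \<open>tail a\<close>, \<open>head a\<close>, \<open>arev a\<close>; see the lemmas below.
\<close>

definition quotient_graph ::
  "('g, 'm) monoid_scheme \<Rightarrow> ('v, 'e) pre_digraph \<Rightarrow> ('g \<Rightarrow> 'v \<Rightarrow> 'v) \<Rightarrow> ('g \<Rightarrow> 'e \<Rightarrow> 'e)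
    \<Rightarrow> ('v set, 'e set) pre_digraph" where
  "quotient_graph G \<Gamma> \<phi>V \<phi>E =
     \<lparr> verts = orbits G (verts \<Gamma>) \<phi>V, arcs = orbits G (arcs \<Gamma>) \<phi>E,
       tail = (\<lambda>X. tail \<Gamma> ` X), head = (\<lambda>X. head \<Gamma> ` X) \<rparr>"

definition quotient_arev ::
  "('g, 'm) monoid_scheme \<Rightarrow> ('v, 'e) pre_digraph \<Rightarrow> ('e \<Rightarrow> 'e) \<Rightarrow> ('g \<Rightarrow> 'e \<Rightarrow> 'e)
    \<Rightarrow> 'e set \<Rightarrow> 'e set" where
  "quotient_arev G \<Gamma> arev \<phi>E X = (if X \<in> orbits G (arcs \<Gamma>) \<phi>E then arev ` X else X)"

text \<open>
  The quotient map \<open>(orbit G \<phi>V, orbit G \<phi>E)\<close> is a morphism of graphs, so its restriction to a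
  subgraph is an isomorphism iff it is bijective on vertices and on oriented edges.
\<close>

definition is_lift ::
  "('g, 'm) monoid_scheme \<Rightarrow> ('v, 'e) pre_digraph \<Rightarrow> ('e \<Rightarrow> 'e) \<Rightarrow> ('g \<Rightarrow> 'v \<Rightarrow> 'v) \<Rightarrow> ('g \<Rightarrow> 'e \<Rightarrow> 'e)
    \<Rightarrow> ('v, 'e) pre_digraph \<Rightarrow> bool" where
  "is_lift G \<Gamma> arev \<phi>V \<phi>E \<Lambda> \<longleftrightarrow>
     subgraph \<Lambda> \<Gamma> \<and> arev ` arcs \<Lambda> \<subseteq> arcs \<Lambda> \<and>
     bij_betw (orbit G \<phi>V) (verts \<Lambda>) (verts (quotient_graph G \<Gamma> \<phi>V \<phi>E)) \<and>
     bij_betw (orbit G \<phi>E) (arcs \<Lambda>) (arcs (quotient_graph G \<Gamma> \<phi>V \<phi>E))"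

context graph_action
begin

lemma tail_image_orbit: "a \<in> arcs \<Gamma> \<Longrightarrow> tail \<Gamma> ` orbit G \<phi>E a = orbit G \<phi>V (tail \<Gamma> a)"
  unfolding orbit_def using tail_action by (force simp: image_iff)

lemma head_image_orbit: "a \<in> arcs \<Gamma> \<Longrightarrow> head \<Gamma> ` orbit G \<phi>E a = orbit G \<phi>V (head \<Gamma> a)"
  unfolding orbit_def using head_action by (force simp: image_iff)

lemma arev_image_orbit: "a \<in> arcs \<Gamma> \<Longrightarrow> arev ` orbit G \<phi>E a = orbit G \<phi>E (arev a)"
  unfolding orbit_def using arev_action by (force simp: image_iff)

lemma bidirected_quotient_graph:
  assumes "without_inversion G \<Gamma> arev \<phi>E"
  shows "bidirected_digraph (quotient_graph G \<Gamma> \<phi>V \<phi>E) (quotient_arev G \<Gamma> arev \<phi>E)"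
proof -
  have orb: "orbit G \<phi>E (arev a) \<noteq> orbit G \<phi>E a" if a: "a \<in> arcs \<Gamma>" for a
  proof
    assume "orbit G \<phi>E (arev a) = orbit G \<phi>E a"
    then have "arev a \<in> orbit G \<phi>E a"
      using a arc_action.orbit_refl arev_in_arcs by blast
    then obtain g where "g \<in> carrier G" "\<phi>E g a = arev a"
      by (auto simp: orbit_def)
    then show False
      using assms a by (auto simp: without_inversion_def)
  qed
  have verts: "orbit G \<phi>V v \<in> orbits G (verts \<Gamma>) \<phi>V" if "v \<in> verts \<Gamma>" for v
    using that by (auto simp: orbits_def)
  have arcs: "orbit G \<phi>E a \<in> orbits G (arcs \<Gamma>) \<phi>E" if "a \<in> arcs \<Gamma>" for a
    using that by (auto simp: orbits_def)
  have arev: "quotient_arev G \<Gamma> arev \<phi>E (orbit G \<phi>E a) = orbit G \<phi>E (arev a)"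
    if "a \<in> arcs \<Gamma>" for a
    using that arcs by (simp add: quotient_arev_def arev_image_orbit)
  let ?Q = "quotient_graph G \<Gamma> \<phi>V \<phi>E"
  have arcsE: "\<exists>a \<in> arcs \<Gamma>. X = orbit G \<phi>E a" if "X \<in> arcs ?Q" for X
    using that by (auto simp: quotient_graph_def orbits_def)
  have Q: "verts ?Q = orbits G (verts \<Gamma>) \<phi>V" "arcs ?Q = orbits G (arcs \<Gamma>) \<phi>E"
    "\<And>a. a \<in> arcs \<Gamma> \<Longrightarrow> tail ?Q (orbit G \<phi>E a) = orbit G \<phi>V (tail \<Gamma> a)"
    "\<And>a. a \<in> arcs \<Gamma> \<Longrightarrow> head ?Q (orbit G \<phi>E a) = orbit G \<phi>V (head \<Gamma> a)"
    by (simp_all add: quotient_graph_def tail_image_orbit head_image_orbit)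
  show ?thesis
  proof
    fix X
    show "tail ?Q X \<in> verts ?Q" "head ?Q X \<in> verts ?Q" if "X \<in> arcs ?Q"
      using arcsE[OF that] verts by (auto simp: Q)
    show "X \<in> arcs ?Q \<longleftrightarrow> quotient_arev G \<Gamma> arev \<phi>E X \<noteq> X"
    proof
      show "quotient_arev G \<Gamma> arev \<phi>E X \<noteq> X" if "X \<in> arcs ?Q"
        using arcsE[OF that] orb arev by metis
      show "X \<in> arcs ?Q" if "quotient_arev G \<Gamma> arev \<phi>E X \<noteq> X"
        using that by (auto simp: Q quotient_arev_def split: if_splits)
    qed
    show "quotient_arev G \<Gamma> arev \<phi>E (quotient_arev G \<Gamma> arev \<phi>E X) = X"
      "tail ?Q (quotient_arev G \<Gamma> arev \<phi>E X) = head ?Q X" if "X \<in> arcs ?Q"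
      using arcsE[OF that] by (auto simp: Q arev)
  qed
qed

end


section \<open>Semidirect products\<close>

definition internal_semidirect ::
  "('g, 'm) monoid_scheme \<Rightarrow> 'g set \<Rightarrow> 'g set \<Rightarrow> 'g set \<Rightarrow> bool" where
  "internal_semidirect G S K H \<longleftrightarrow>
     subgroup S G \<and> subgroup K G \<and> subgroup H G \<and>
     K \<lhd> (G\<lparr>carrier := S\<rparr>) \<and> S = K <#>\<^bsub>G\<^esub> H \<and> K \<inter> H = {\<one>\<^bsub>G\<^esub>}"

definition semidirect_product ::
  "('n, 'm) monoid_scheme \<Rightarrow> ('h, 'k) monoid_scheme \<Rightarrow> ('h \<Rightarrow> 'n \<Rightarrow> 'n) \<Rightarrow> ('n \<times> 'h) monoid" where
  "semidirect_product N H \<theta> =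
     \<lparr> carrier = carrier N \<times> carrier H,
       monoid.mult = (\<lambda>(n, h) (n', h'). (n \<otimes>\<^bsub>N\<^esub> \<theta> h n', h \<otimes>\<^bsub>H\<^esub> h')),
       one = (\<one>\<^bsub>N\<^esub>, \<one>\<^bsub>H\<^esub>) \<rparr>"

lemma group_semidirect_product:
  assumes "group N" "group H" "\<theta> \<in> hom H (AutoGroup N)"
  shows "group (semidirect_product N H \<theta>)"
proof -
  interpret N: group N by fact
  interpret H: group H by fact
  have aut: "\<theta> h \<in> hom N N" "\<theta> h \<in> Bij (carrier N)" if "h \<in> carrier H" for h
    using assms(3) that by (auto simp: hom_def AutoGroup_def auto_def Pi_iff)
  have cl: "\<theta> h n \<in> carrier N" if "h \<in> carrier H" "n \<in> carrier N" for h n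
    using aut(1) that by (auto simp: hom_def)
  have mlt: "\<theta> h (n \<otimes>\<^bsub>N\<^esub> n') = \<theta> h n \<otimes>\<^bsub>N\<^esub> \<theta> h n'"
    if "h \<in> carrier H" "n \<in> carrier N" "n' \<in> carrier N" for h n n'
    using aut(1) that by (auto simp: hom_def)
  have comp: "\<theta> (h \<otimes>\<^bsub>H\<^esub> h') n = \<theta> h (\<theta> h' n)"
    if "h \<in> carrier H" "h' \<in> carrier H" "n \<in> carrier N" for h h' n
    using assms(3) that aut
    by (auto simp: hom_def AutoGroup_def BijGroup_def compose_def)
  have one: "\<theta> \<one>\<^bsub>H\<^esub> n = n" if n: "n \<in> carrier N" for n
  proof -
    have "\<theta> \<one>\<^bsub>H\<^esub> (\<theta> \<one>\<^bsub>H\<^esub> n) = \<theta> \<one>\<^bsub>H\<^esub> n"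
      using comp[of "\<one>\<^bsub>H\<^esub>" "\<one>\<^bsub>H\<^esub>" n] n by simp
    moreover have "inj_on (\<theta> \<one>\<^bsub>H\<^esub>) (carrier N)"
      using aut(2)[of "\<one>\<^bsub>H\<^esub>"] by (simp add: Bij_def bij_betw_def)
    ultimately show ?thesis
      using n cl by (meson H.one_closed inj_onD)
  qed
  show ?thesis
  proof (rule groupI)
    fix x assume "x \<in> carrier (semidirect_product N H \<theta>)"
    then obtain n h where x: "x = (n, h)" "n \<in> carrier N" "h \<in> carrier H"
      by (auto simp: semidirect_product_def)
    let ?n = "inv\<^bsub>N\<^esub> (\<theta> (inv\<^bsub>H\<^esub> h) n)"
    have "(?n, inv\<^bsub>H\<^esub> h) \<in> carrier (semidirect_product N H \<theta>)"
      "(?n, inv\<^bsub>H\<^esub> h) \<otimes>\<^bsub>semidirect_product N H \<theta>\<^esub> x = \<one>\<^bsub>semidirect_product N H \<theta>\<^esub>"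
      using x cl by (auto simp: semidirect_product_def)
    then show "\<exists>y \<in> carrier (semidirect_product N H \<theta>).
        y \<otimes>\<^bsub>semidirect_product N H \<theta>\<^esub> x = \<one>\<^bsub>semidirect_product N H \<theta>\<^esub>"
      by blast
  qed (auto simp: semidirect_product_def cl mlt comp one N.m_assoc H.m_assoc)
qed


section \<open>Free products with amalgamation\<close>

text \<open>
  The free product of \<open>A\<close> and \<open>B\<close> amalgamated along \<open>C\<close> via \<open>i: C \<rightarrow> A\<close> and \<open>j: C \<rightarrow> B\<close> consists of
  the words over the disjoint union of \<open>A\<close> and \<open>B\<close> modulo the congruence generated by the
  multiplication tables of \<open>A\<close> and \<open>B\<close> and the relations \<open>i c = j c\<close>.
\<close>

definition amalgam_words ::
  "('a, 'm) monoid_scheme \<Rightarrow> ('b, 'n) monoid_scheme \<Rightarrow> ('a + 'b) list set" where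
  "amalgam_words A B = lists (carrier A <+> carrier B)"

inductive amalgam_cong ::
  "('a, 'm) monoid_scheme \<Rightarrow> ('b, 'n) monoid_scheme \<Rightarrow> ('c, 'k) monoid_scheme
    \<Rightarrow> ('c \<Rightarrow> 'a) \<Rightarrow> ('c \<Rightarrow> 'b) \<Rightarrow> ('a + 'b) list \<Rightarrow> ('a + 'b) list \<Rightarrow> bool"
  for A B C i j where
  refl: "w \<in> amalgam_words A B \<Longrightarrow> amalgam_cong A B C i j w w"
| sym: "amalgam_cong A B C i j u v \<Longrightarrow> amalgam_cong A B C i j v u"
| trans: "amalgam_cong A B C i j u v \<Longrightarrow> amalgam_cong A B C i j v w \<Longrightarrow> amalgam_cong A B C i j u w"
| append: "amalgam_cong A B C i j u u' \<Longrightarrow> amalgam_cong A B C i j v v'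
    \<Longrightarrow> amalgam_cong A B C i j (u @ v) (u' @ v')"
| one_left: "amalgam_cong A B C i j [Inl \<one>\<^bsub>A\<^esub>] []"
| one_right: "amalgam_cong A B C i j [Inr \<one>\<^bsub>B\<^esub>] []"
| mult_left: "a \<in> carrier A \<Longrightarrow> a' \<in> carrier A
    \<Longrightarrow> amalgam_cong A B C i j [Inl a, Inl a'] [Inl (a \<otimes>\<^bsub>A\<^esub> a')]"
| mult_right: "b \<in> carrier B \<Longrightarrow> b' \<in> carrier B
    \<Longrightarrow> amalgam_cong A B C i j [Inr b, Inr b'] [Inr (b \<otimes>\<^bsub>B\<^esub> b')]"
| amalgamate: "c \<in> carrier C \<Longrightarrow> amalgam_cong A B C i j [Inl (i c)] [Inr (j c)]"

definition amalgam_class ::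
  "('a, 'm) monoid_scheme \<Rightarrow> ('b, 'n) monoid_scheme \<Rightarrow> ('c, 'k) monoid_scheme
    \<Rightarrow> ('c \<Rightarrow> 'a) \<Rightarrow> ('c \<Rightarrow> 'b) \<Rightarrow> ('a + 'b) list \<Rightarrow> ('a + 'b) list set" where
  "amalgam_class A B C i j u = {w. amalgam_cong A B C i j u w}"

definition amalgam ::
  "('a, 'm) monoid_scheme \<Rightarrow> ('b, 'n) monoid_scheme \<Rightarrow> ('c, 'k) monoid_scheme
    \<Rightarrow> ('c \<Rightarrow> 'a) \<Rightarrow> ('c \<Rightarrow> 'b) \<Rightarrow> ('a + 'b) list set monoid" where
  "amalgam A B C i j =
     \<lparr> carrier = amalgam_class A B C i j ` amalgam_words A B,
       monoid.mult = (\<lambda>X Y. \<Union>u \<in> X. \<Union>v \<in> Y. amalgam_class A B C i j (u @ v)),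
       one = amalgam_class A B C i j [] \<rparr>"

definition amalgam_inl ::
  "('a, 'm) monoid_scheme \<Rightarrow> ('b, 'n) monoid_scheme \<Rightarrow> ('c, 'k) monoid_scheme
    \<Rightarrow> ('c \<Rightarrow> 'a) \<Rightarrow> ('c \<Rightarrow> 'b) \<Rightarrow> 'a \<Rightarrow> ('a + 'b) list set" where
  "amalgam_inl A B C i j a = amalgam_class A B C i j [Inl a]"

definition amalgam_inr ::
  "('a, 'm) monoid_scheme \<Rightarrow> ('b, 'n) monoid_scheme \<Rightarrow> ('c, 'k) monoid_scheme
    \<Rightarrow> ('c \<Rightarrow> 'a) \<Rightarrow> ('c \<Rightarrow> 'b) \<Rightarrow> 'b \<Rightarrow> ('a + 'b) list set" where
  "amalgam_inr A B C i j b = amalgam_class A B C i j [Inr b]"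

locale amalgam_data =
  A: group A + B: group B + C: group C
  for A :: "('a, 'm) monoid_scheme" and B :: "('b, 'n) monoid_scheme"
    and C :: "('c, 'k) monoid_scheme" +
  fixes i :: "'c \<Rightarrow> 'a" and j :: "'c \<Rightarrow> 'b"
  assumes i_hom: "i \<in> hom C A" and j_hom: "j \<in> hom C B"
begin

abbreviation "W \<equiv> amalgam_words A B"
abbreviation cong_word (infix \<open>\<approx>\<close> 50) where "u \<approx> v \<equiv> amalgam_cong A B C i j u v"
abbreviation "cls \<equiv> amalgam_class A B C i j"
abbreviation "M \<equiv> amalgam A B C i j"
abbreviation "inl \<equiv> amalgam_inl A B C i j"
abbreviation "inr \<equiv> amalgam_inr A B C i j"

lemma cong_words: "u \<approx> v \<Longrightarrow> u \<in> W \<and> v \<in> W"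
  by (induction rule: amalgam_cong.induct)
    (use i_hom j_hom in \<open>auto simp: amalgam_words_def hom_def\<close>)

lemma cls_eq_iff: "u \<in> W \<Longrightarrow> cls u = cls v \<longleftrightarrow> u \<approx> v"
  unfolding amalgam_class_def
  by (blast intro: amalgam_cong.refl amalgam_cong.sym amalgam_cong.trans)

lemma mult_cls: "u \<in> W \<Longrightarrow> v \<in> W \<Longrightarrow> cls u \<otimes>\<^bsub>M\<^esub> cls v = cls (u @ v)"
  unfolding amalgam_def amalgam_class_def
  by (auto intro: amalgam_cong.intros)

lemma append_words: "u \<in> W \<Longrightarrow> v \<in> W \<Longrightarrow> u @ v \<in> W"
  by (auto simp: amalgam_words_def)

lemma ex_left_inverse: "w \<in> W \<Longrightarrow> \<exists>w' \<in> W. w' @ w \<approx> []"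
proof (induction w)
  case Nil
  then show ?case by (auto intro: amalgam_cong.refl)
next
  case (Cons x w)
  then obtain w' where w: "w \<in> W" "w' \<in> W" "w' @ w \<approx> []"
    by (auto simp: amalgam_words_def)
  have "\<exists>y. [y] \<in> W \<and> [y, x] \<approx> []"
  proof (cases x)
    case (Inl a)
    then have a: "a \<in> carrier A" using Cons by (auto simp: amalgam_words_def)
    have "[Inl (inv\<^bsub>A\<^esub> a), Inl a] \<approx> [Inl \<one>\<^bsub>A\<^esub>]"
      using amalgam_cong.mult_left[of "inv\<^bsub>A\<^esub> a" A a B C i j] a by simp
    with a Inl show ?thesis
      by (intro exI[of _ "Inl (inv\<^bsub>A\<^esub> a)"])
        (auto simp: amalgam_words_def intro: amalgam_cong.trans amalgam_cong.one_left)
  next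
    case (Inr b)
    then have b: "b \<in> carrier B" using Cons by (auto simp: amalgam_words_def)
    have "[Inr (inv\<^bsub>B\<^esub> b), Inr b] \<approx> [Inr \<one>\<^bsub>B\<^esub>]"
      using amalgam_cong.mult_right[of "inv\<^bsub>B\<^esub> b" B b A C i j] b by simp
    with b Inr show ?thesis
      by (intro exI[of _ "Inr (inv\<^bsub>B\<^esub> b)"])
        (auto simp: amalgam_words_def intro: amalgam_cong.trans amalgam_cong.one_right)
  qed
  then obtain y where y: "[y] \<in> W" "[y, x] \<approx> []" by blast
  have "w' @ ([y, x] @ w) \<approx> w' @ ([] @ w)"
    using w y by (intro amalgam_cong.append amalgam_cong.refl)
  then have "(w' @ [y]) @ x # w \<approx> []"
    using w(3) by (auto intro: amalgam_cong.trans)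
  then show ?case using w y append_words by blast
qed

lemma group_amalgam: "group M"
proof (rule groupI)
  have car: "carrier M = cls ` W" and one: "\<one>\<^bsub>M\<^esub> = cls []"
    by (auto simp: amalgam_def)
  have nil: "[] \<in> W" by (simp add: amalgam_words_def)
  show "\<one>\<^bsub>M\<^esub> \<in> carrier M" using nil by (simp add: car one)
  fix x assume x: "x \<in> carrier M"
  then obtain u where u: "x = cls u" "u \<in> W" by (auto simp: car)
  show "\<one>\<^bsub>M\<^esub> \<otimes>\<^bsub>M\<^esub> x = x" using u nil by (simp add: one mult_cls)
  obtain w where "w \<in> W" "w @ u \<approx> []" using ex_left_inverse u by blast
  then have "cls w \<otimes>\<^bsub>M\<^esub> x = \<one>\<^bsub>M\<^esub>"
    using u nil by (simp add: mult_cls one cls_eq_iff append_words)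
  then show "\<exists>y \<in> carrier M. y \<otimes>\<^bsub>M\<^esub> x = \<one>\<^bsub>M\<^esub>" using \<open>w \<in> W\<close> car by blast
  fix y assume "y \<in> carrier M"
  then obtain v where v: "y = cls v" "v \<in> W" by (auto simp: car)
  show "x \<otimes>\<^bsub>M\<^esub> y \<in> carrier M" using u v by (auto simp: mult_cls car append_words)
  fix z assume "z \<in> carrier M"
  then obtain w where "z = cls w" "w \<in> W" by (auto simp: car)
  then show "x \<otimes>\<^bsub>M\<^esub> y \<otimes>\<^bsub>M\<^esub> z = x \<otimes>\<^bsub>M\<^esub> (y \<otimes>\<^bsub>M\<^esub> z)"
    using u v by (simp add: mult_cls append_words)
qed

lemma inl_hom: "inl \<in> hom A M"
proof (rule homI)
  show "inl a \<in> carrier M" if "a \<in> carrier A" for a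
    using that by (auto simp: amalgam_inl_def amalgam_def amalgam_words_def)
  show "inl (a \<otimes>\<^bsub>A\<^esub> a') = inl a \<otimes>\<^bsub>M\<^esub> inl a'" if "a \<in> carrier A" "a' \<in> carrier A" for a a'
  proof -
    have "[Inl a] \<in> W" "[Inl a'] \<in> W" "[Inl (a \<otimes>\<^bsub>A\<^esub> a')] \<in> W"
      using that by (auto simp: amalgam_words_def)
    then show ?thesis
      using that amalgam_cong.mult_left[of a A a' B C i j]
      by (simp add: amalgam_inl_def mult_cls cls_eq_iff amalgam_cong.sym)
  qed
qed

lemma inr_hom: "inr \<in> hom B M"
proof (rule homI)
  show "inr b \<in> carrier M" if "b \<in> carrier B" for b
    using that by (auto simp: amalgam_inr_def amalgam_def amalgam_words_def)
  show "inr (b \<otimes>\<^bsub>B\<^esub> b') = inr b \<otimes>\<^bsub>M\<^esub> inr b'" if "b \<in> carrier B" "b' \<in> carrier B" for b b'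
  proof -
    have "[Inr b] \<in> W" "[Inr b'] \<in> W" "[Inr (b \<otimes>\<^bsub>B\<^esub> b')] \<in> W"
      using that by (auto simp: amalgam_words_def)
    then show ?thesis
      using that amalgam_cong.mult_right[of b B b' A C i j]
      by (simp add: amalgam_inr_def mult_cls cls_eq_iff amalgam_cong.sym)
  qed
qed

lemma inl_inr: "c \<in> carrier C \<Longrightarrow> inl (i c) = inr (j c)"
  using amalgam_cong.amalgamate[of c C A B i j] cong_words
  by (simp add: amalgam_inl_def amalgam_inr_def cls_eq_iff)

lemma hom_unique:
  assumes K: "group K" and h: "h \<in> hom M K" "h' \<in> hom M K"
    and l: "\<And>a. a \<in> carrier A \<Longrightarrow> h (inl a) = h' (inl a)"
    and r: "\<And>b. b \<in> carrier B \<Longrightarrow> h (inr b) = h' (inr b)"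
    and x: "x \<in> carrier M"
  shows "h x = h' x"
proof -
  have "h (cls w) = h' (cls w)" if "w \<in> W" for w
    using that
  proof (induction w)
    case Nil
    have "h \<one>\<^bsub>M\<^esub> = \<one>\<^bsub>K\<^esub>" "h' \<one>\<^bsub>M\<^esub> = \<one>\<^bsub>K\<^esub>"
      using h K group_amalgam hom_one by blast+
    then show ?case by (simp add: amalgam_def)
  next
    case (Cons z w)
    then have w: "[z] \<in> W" "w \<in> W" by (auto simp: amalgam_words_def)
    have z: "h (cls [z]) = h' (cls [z])"
      using w(1) l r by (auto simp: amalgam_words_def amalgam_inl_def amalgam_inr_def)
    have "cls (z # w) = cls [z] \<otimes>\<^bsub>M\<^esub> cls w" using mult_cls[OF w] by simp
    moreover have "cls [z] \<in> carrier M" "cls w \<in> carrier M"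
      using w by (auto simp: amalgam_def)
    ultimately show ?case using h z Cons.IH[OF w(2)] by (simp add: hom_mult)
  qed
  then show ?thesis using x by (auto simp: amalgam_def)
qed

lemma universal_property:
  assumes K: "group K" and f: "f \<in> hom A K" and g: "g \<in> hom B K"
    and fg: "\<And>c. c \<in> carrier C \<Longrightarrow> f (i c) = g (j c)"
  shows "\<exists>h \<in> hom M K. (\<forall>a \<in> carrier A. h (inl a) = f a) \<and> (\<forall>b \<in> carrier B. h (inr b) = g b)"
proof -
  interpret K: group K by fact
  define ev where "ev w = foldr (\<lambda>z r. case_sum f g z \<otimes>\<^bsub>K\<^esub> r) w \<one>\<^bsub>K\<^esub>" for w
  have fc: "f a \<in> carrier K" if "a \<in> carrier A" for a using f that by (auto simp: hom_def)
  have gc: "g b \<in> carrier K" if "b \<in> carrier B" for b using g that by (auto simp: hom_def)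
  have ev_closed: "ev w \<in> carrier K" if "w \<in> W" for w
    using that by (induction w) (auto simp: ev_def amalgam_words_def fc gc)
  have ev_append: "ev (u @ v) = ev u \<otimes>\<^bsub>K\<^esub> ev v" if "u \<in> W" "v \<in> W" for u v
    using that(1)
  proof (induction u)
    case Nil
    then show ?case using ev_closed[OF that(2)] by (simp add: ev_def)
  next
    case (Cons z u)
    then have u: "u \<in> W" and z: "case_sum f g z \<in> carrier K"
      by (auto simp: amalgam_words_def fc gc)
    have "ev (z # w) = case_sum f g z \<otimes>\<^bsub>K\<^esub> ev w" for w by (simp add: ev_def)
    then show ?case using Cons.IH[OF u] z ev_closed[OF u] ev_closed[OF that(2)]
      by (simp add: K.m_assoc)
  qed
  have ev_cong: "ev u = ev v" if "u \<approx> v" for u v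
    using that
  proof (induction rule: amalgam_cong.induct)
    case (append u u' v v')
    then show ?case using cong_words by (metis ev_append)
  next
    case (amalgamate c)
    then show ?case
      using fg i_hom j_hom by (simp add: ev_def)
  qed (use f g K A.is_group B.is_group in
      \<open>auto simp: ev_def fc gc hom_mult hom_one K.m_assoc\<close>)
  define h where "h X = ev (SOME u. u \<in> X)" for X
  have h_cls: "h (cls u) = ev u" if "u \<in> W" for u
  proof -
    have "u \<in> cls u" using that by (simp add: amalgam_class_def amalgam_cong.refl)
    then have "(SOME w. w \<in> cls u) \<in> cls u" by (rule someI)
    then show ?thesis by (simp add: h_def amalgam_class_def ev_cong)
  qed
  have "h \<in> hom M K"
  proof (rule homI)
    have car: "carrier M = cls ` W" by (simp add: amalgam_def)
    fix x assume "x \<in> carrier M"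
    then obtain u where u: "x = cls u" "u \<in> W" unfolding car by blast
    then show "h x \<in> carrier K" by (simp add: h_cls ev_closed)
    fix y assume "y \<in> carrier M"
    then obtain v where v: "y = cls v" "v \<in> W" unfolding car by blast
    show "h (x \<otimes>\<^bsub>M\<^esub> y) = h x \<otimes>\<^bsub>K\<^esub> h y"
      using u v by (simp add: mult_cls h_cls append_words ev_append)
  qed
  moreover have "h (inl a) = f a" if "a \<in> carrier A" for a
    using that h_cls[of "[Inl a]"]
    by (simp add: amalgam_inl_def amalgam_words_def ev_def fc InlI)
  moreover have "h (inr b) = g b" if "b \<in> carrier B" for b
    using that h_cls[of "[Inr b]"]
    by (simp add: amalgam_inr_def amalgam_words_def ev_def gc InrI)
  ultimately show ?thesis by blast
qed

end


section \<open>The action by conjugation\<close>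

abbreviation subgroup_amalgam ::
  "('g, 'm) monoid_scheme \<Rightarrow> 'g set \<Rightarrow> 'g set \<Rightarrow> 'g set \<Rightarrow> ('g + 'g) list set monoid" where
  "subgroup_amalgam G K L C \<equiv>
     amalgam (G\<lparr>carrier := K\<rparr>) (G\<lparr>carrier := L\<rparr>) (G\<lparr>carrier := C\<rparr>) (\<lambda>x. x) (\<lambda>x. x)"

definition conjugation_action ::
  "('g, 'm) monoid_scheme \<Rightarrow> 'g set \<Rightarrow> 'g set \<Rightarrow> 'g set \<Rightarrow> 'g set
    \<Rightarrow> ('g \<Rightarrow> ('g + 'g) list set \<Rightarrow> ('g + 'g) list set) \<Rightarrow> bool" where
  "conjugation_action G K L C H \<theta> \<longleftrightarrow>
     (let inl = amalgam_inl (G\<lparr>carrier := K\<rparr>) (G\<lparr>carrier := L\<rparr>) (G\<lparr>carrier := C\<rparr>) (\<lambda>x. x) (\<lambda>x. x);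
          inr = amalgam_inr (G\<lparr>carrier := K\<rparr>) (G\<lparr>carrier := L\<rparr>) (G\<lparr>carrier := C\<rparr>) (\<lambda>x. x) (\<lambda>x. x)
      in \<theta> \<in> hom (G\<lparr>carrier := H\<rparr>) (AutoGroup (subgroup_amalgam G K L C)) \<and>
         (\<forall>h \<in> H. \<forall>k \<in> K. h \<otimes>\<^bsub>G\<^esub> k \<otimes>\<^bsub>G\<^esub> inv\<^bsub>G\<^esub> h \<in> K \<and>
            \<theta> h (inl k) = inl (h \<otimes>\<^bsub>G\<^esub> k \<otimes>\<^bsub>G\<^esub> inv\<^bsub>G\<^esub> h)) \<and>
         (\<forall>h \<in> H. \<forall>l \<in> L. h \<otimes>\<^bsub>G\<^esub> l \<otimes>\<^bsub>G\<^esub> inv\<^bsub>G\<^esub> h \<in> L \<and>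
            \<theta> h (inr l) = inr (h \<otimes>\<^bsub>G\<^esub> l \<otimes>\<^bsub>G\<^esub> inv\<^bsub>G\<^esub> h)))"

lemma conjugation_action_unique:
  assumes "group G" "subgroup K G" "subgroup L G" "subgroup C G" "C \<subseteq> K" "C \<subseteq> L"
    and "conjugation_action G K L C H \<theta>" "conjugation_action G K L C H \<theta>'" "h \<in> H"
  shows "\<theta> h = \<theta>' h"
proof -
  interpret G: group G by fact
  interpret amalgam_data "G\<lparr>carrier := K\<rparr>" "G\<lparr>carrier := L\<rparr>" "G\<lparr>carrier := C\<rparr>"
    "\<lambda>x. x" "\<lambda>x. x"
    using assms(2-6)
    by (auto intro!: amalgam_data.intro amalgam_data_axioms.intro G.subgroup_imp_group
        simp: hom_def)
  have "\<theta> h \<in> auto M" "\<theta>' h \<in> auto M"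
    using assms(7-9) by (auto simp: conjugation_action_def Let_def hom_def AutoGroup_def)
  then have *: "\<theta> h \<in> hom M M" "\<theta>' h \<in> hom M M"
    "\<theta> h \<in> extensional (carrier M)" "\<theta>' h \<in> extensional (carrier M)"
    by (auto simp: auto_def Bij_def)
  have "\<theta> h x = \<theta>' h x" if "x \<in> carrier M" for x
  proof (rule hom_unique[OF group_amalgam *(1,2) _ _ that])
    show "\<theta> h (inl k) = \<theta>' h (inl k)" if "k \<in> carrier (G\<lparr>carrier := K\<rparr>)" for k
      using assms(7-9) that unfolding conjugation_action_def Let_def by simp
    show "\<theta> h (inr l) = \<theta>' h (inr l)" if "l \<in> carrier (G\<lparr>carrier := L\<rparr>)" for l
      using assms(7-9) that unfolding conjugation_action_def Let_def by simp
  qed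
  then show ?thesis using *(3,4) by (auto intro: extensionalityI)
qed

end

theory Submission
  imports Defs
begin

text \<open>
  The amalgam \<open>G\<^sub>P *\<^bsub>G\<^sub>y\<^esub> G\<^sub>Q\<close> maps to \<open>G\<close> compatibly with conjugation by \<open>H\<close>, which gives a homomorphism
  \<open>(m, h) \<mapsto> f m \<cdot> h\<close> from the semidirect product to \<open>G\<close>. It is surjective because the tree is
  connected: the stabilizers of \<open>P\<close> and \<open>Q\<close> generate \<open>G\<close>. It is injective because the tree has no
  circuits: a nonempty alternating word in \<open>G\<^sub>P - G\<^sub>y\<close> and \<open>G\<^sub>Q - G\<^sub>y\<close> describes a walk without
  backtracking from \<open>y\<close> to its translate by the value of the word, so this value is not in the
  stabilizer \<open>G\<^sub>y H\<close> of \<open>y\<close>.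

  The sides \<open>P\<close> and \<open>Q\<close> are indexed by \<open>True\<close> and \<open>False\<close>.
\<close>


section \<open>Alternating words and their products\<close>

fun alternating :: "(bool \<Rightarrow> 'g set) \<Rightarrow> bool \<Rightarrow> 'g list \<Rightarrow> bool" where
  "alternating X s [] \<longleftrightarrow> True"
| "alternating X s (x # xs) \<longleftrightarrow> x \<in> X s \<and> alternating X (\<not> s) xs"

text \<open>Serves to turn reduced words of the amalgam into words in the vertex stabilizers whose
  letters move the edge.\<close>

lemma alternating_mono:
  "alternating X s xs \<Longrightarrow> (\<And>s. X s \<subseteq> Y s) \<Longrightarrow> alternating Y s xs"
  by (induction xs arbitrary: s) auto

definition list_prod :: "('g, 'm) monoid_scheme \<Rightarrow> 'g list \<Rightarrow> 'g" where
  "list_prod G xs = foldr (\<otimes>\<^bsub>G\<^esub>) xs \<one>\<^bsub>G\<^esub>"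

lemma list_prod_simps [simp]:
  "list_prod G [] = \<one>\<^bsub>G\<^esub>" "list_prod G (x # xs) = x \<otimes>\<^bsub>G\<^esub> list_prod G xs"
  by (simp_all add: list_prod_def)

lemma (in monoid) list_prod_closed: "set xs \<subseteq> carrier G \<Longrightarrow> list_prod G xs \<in> carrier G"
  by (induction xs) auto

lemma alternating_set:
  assumes "alternating X s xs" shows "set xs \<subseteq> X True \<union> X False"
  using assms
proof (induction xs arbitrary: s)
  case (Cons x xs)
  then show ?case by (cases s) auto
qed simp


section \<open>Reduced walks in trees\<close>

text \<open>Induction on the length: a walk that revisits a vertex contains a shorter closed piece,
  and a contiguous piece of a reduced walk is reduced. Neither hypothesis nor conclusion compares
  the last arc with the first.\<close>

lemma (in wf_digraph) closed_reduced_walk_imp_circuit: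
  assumes "awalk u p u" "p \<noteq> []" "successively (\<lambda>a b. b \<noteq> arev a) p"
  shows "\<exists>q. circuit G arev q"
  using assms
proof (induction "length p" arbitrary: u p rule: less_induct)
  case less
  show ?case
  proof (cases "distinct (tl (awalk_verts u p))")
    case True
    then have "cycle p" using less.prems by (auto simp: cycle_def)
    with less.prems(3) have "circuit G arev p"
      by (simp add: circuit_def successively_conv_nth)
    then show ?thesis ..
  next
    case False
    obtain a p' where p: "p = a # p'" using less.prems(2) by (cases p) auto
    \<comment> \<open>The vertices tested for distinctness are those of the walk without its first
      arc, so the closed piece is found in \<open>p'\<close> and is strictly shorter than
      \<open>p\<close>.\<close>
    have w: "awalk (head G a) p' u" using less.prems(1) unfolding p awalk_Cons_iff by blast
    obtain q r s w where qrs: "p' = q @ r @ s" "0 < length r" "awalk w r w"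
      using awalk_not_distinct_decomp[OF w] False by (auto simp: p)
    have "successively (\<lambda>a b. b \<noteq> arev a) r"
      using less.prems(3) unfolding p qrs(1)
      by (auto simp: successively_Cons successively_append_iff)
    then show ?thesis
      using less.hyps[of r w] qrs by (auto simp: p)
  qed
qed


section \<open>Trees with a segment as fundamental domain\<close>

text \<open>Indexing by \<open>bool\<close> lets one argument treat both ends: \<open>ed s\<close>
  is the orientation of the base edge that points to \<open>pt s\<close>, and negation is both
  passage to the other end and reversal.\<close>

locale segment_action = graph_action G \<Gamma> arev \<phi>V \<phi>E
  for G :: "('g, 'm) monoid_scheme" (structure) and \<Gamma> :: "('v, 'e) pre_digraph"
    and arev \<phi>V \<phi>E +
  fixes pt :: "bool \<Rightarrow> 'v" and ed :: "bool \<Rightarrow> 'e"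
  assumes ed_arcs [simp]: "ed s \<in> arcs \<Gamma>"
    and head_ed [simp]: "head \<Gamma> (ed s) = pt s"
    and arev_ed [simp]: "arev (ed s) = ed (\<not> s)"
    and orbits_disjoint: "g \<in> carrier G \<Longrightarrow> \<phi>V g (pt s) \<noteq> pt (\<not> s)"
    and arc_orbits: "a \<in> arcs \<Gamma> \<Longrightarrow> \<exists>g \<in> carrier G. \<exists>s. a = \<phi>E g (ed s)"
begin

sublocale group G
  using vertex_action.group_hom by (rule group_hom.axioms(1))

lemma tail_ed [simp]: "tail \<Gamma> (ed s) = pt (\<not> s)"
  using tail_arev[OF ed_arcs, of "\<not> s"] by simp

lemma pt_verts [simp]: "pt s \<in> verts \<Gamma>"
  using head_in_verts[OF ed_arcs, of s] by simp

text \<open>The action commutes with \<open>arev\<close>, so fixing an oriented edge means fixing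
  its reverse. Hence the single group \<open>estab\<close> serves both orientations.\<close>

lemma stabilizer_ed: "stabilizer G \<phi>E (ed s) = stabilizer G \<phi>E (ed t)"
proof -
  have "stabilizer G \<phi>E (ed s) \<subseteq> stabilizer G \<phi>E (ed (\<not> s))" for s
    using arev_action[OF _ ed_arcs, of _ s] by (auto simp: stabilizer_def)
  from this[of s] this[of "\<not> s"] show ?thesis by (cases s; cases t) auto
qed

lemma arc_image: "g \<in> carrier G \<Longrightarrow> a \<in> arcs \<Gamma> \<Longrightarrow> \<phi>E g a \<in> arcs \<Gamma>"
  using arc_action.element_image by blast

lemma awalk_image:
  assumes "g \<in> carrier G" "awalk u p v"
  shows "awalk (\<phi>V g u) (map (\<phi>E g) p) (\<phi>V g v)"
  using assms(2)
proof (induction p arbitrary: u)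
  case Nil
  then show ?case
    using vertex_action.element_image[OF assms(1)] by (auto simp: awalk_Nil_iff)
next
  case (Cons a p)
  then show ?case
    using assms(1) by (auto simp: awalk_Cons_iff arc_image tail_action head_action)
qed

abbreviation "vstab s \<equiv> stabilizer G \<phi>V (pt s)"
abbreviation "estab \<equiv> stabilizer G \<phi>E (ed True)"

text \<open>
  For letters \<open>x\<^sub>i\<close> taken alternately from the two vertex stabilizers this is the walk with arcs
  \<open>ed s\<close>, \<open>x\<^sub>1 (ed (\<not> s))\<close>, \<open>x\<^sub>1 x\<^sub>2 (ed s)\<close>, \<dots>; it backtracks at the letters that fix the edge.
\<close>

fun word_walk :: "bool \<Rightarrow> 'g list \<Rightarrow> 'e list" where
  "word_walk s [] = [ed s]"
| "word_walk s (x # xs) = ed s # map (\<phi>E x) (word_walk (\<not> s) xs)"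

lemma hd_word_walk: "word_walk s xs \<noteq> [] \<and> hd (word_walk s xs) = ed s"
  by (cases xs) auto

text \<open>Induction on the word: a first letter \<open>x\<close> in \<open>vstab s\<close>
  translates the remaining walk, which starts at \<open>pt s\<close>, to one still starting there,
  so it can follow \<open>ed s\<close>. The witness \<open>t\<close> is the side on which the last
  arc lies.\<close>

lemma word_walk_properties:
  assumes "alternating (\<lambda>s. vstab s - estab) s xs"
  shows "\<exists>t. awalk (pt (\<not> s)) (word_walk s xs) (\<phi>V (list_prod G xs) (pt t)) \<and>
    last (word_walk s xs) = \<phi>E (list_prod G xs) (ed t) \<and>
    successively (\<lambda>a b. b \<noteq> arev a) (word_walk s xs)"
  using assms
proof (induction xs arbitrary: s)
  case Nil
  have "\<phi>V \<one> (pt s) = pt s" "\<phi>E \<one> (ed s) = ed s"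
    using vertex_action.stabilizer_one_closed[OF pt_verts, of s]
      arc_action.stabilizer_one_closed[OF ed_arcs, of s] by (simp_all add: stabilizer_def)
  then show ?case by (intro exI[of _ s]) (simp add: awalk_simps)
next
  case (Cons x xs)
  let ?w = "word_walk (\<not> s) xs" and ?g = "list_prod G xs"
  from Cons.prems have x: "x \<in> carrier G" "\<phi>V x (pt s) = pt s" "x \<notin> estab"
    and alt: "alternating (\<lambda>s. vstab s - estab) (\<not> s) xs"
    by (auto simp: stabilizer_def)
  have g: "?g \<in> carrier G"
    using alternating_set[OF alt] by (intro list_prod_closed) (auto simp: stabilizer_def)
  obtain t where t: "awalk (pt s) ?w (\<phi>V ?g (pt t))" "last ?w = \<phi>E ?g (ed t)"
    "successively (\<lambda>a b. b \<noteq> arev a) ?w"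
    using Cons.IH[OF alt] by auto
  have sub: "set ?w \<subseteq> arcs \<Gamma>" using t(1) by blast
  have "awalk (pt s) (map (\<phi>E x) ?w) (\<phi>V (x \<otimes> ?g) (pt t))"
    using awalk_image[OF x(1) t(1)] x g by (simp add: vertex_action.composition_rule)
  moreover have "last (word_walk s (x # xs)) = \<phi>E (x \<otimes> ?g) (ed t)"
    using t(2) x g hd_word_walk[of "\<not> s" xs]
    by (simp add: last_map arc_action.composition_rule)
  \<comment> \<open>This excludes backtracking at the new junction: the reverse of
    \<open>ed s\<close> is \<open>ed (\<not> s)\<close>, while the translated walk begins with the
    image of that arc under \<open>x\<close>.\<close>
  moreover have "\<phi>E x (ed (\<not> s)) \<noteq> ed (\<not> s)"
    using x stabilizer_ed[of "\<not> s" True] by (auto simp: stabilizer_def)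
  moreover have "successively (\<lambda>a b. b \<noteq> arev a) (map (\<phi>E x) ?w)"
    unfolding successively_map
  proof (rule successively_mono[OF t(3)])
    fix a b assume "a \<in> set ?w" "b \<in> set ?w" "b \<noteq> arev a"
    then show "\<phi>E x b \<noteq> arev (\<phi>E x a)"
      using sub arc_action.inj_prop[OF x(1)] arev_action[OF x(1), of a]
      by (metis arev_in_arcs inj_onD subsetD)
  qed
  ultimately show ?case
    using hd_word_walk[of "\<not> s" xs]
    by (intro exI[of _ t]) (auto simp: awalk_Cons_iff successively_Cons hd_map)
qed

text \<open>If the product fixed the edge, the walk of the word would start with \<open>ed s\<close>
  and end with one of the two orientations of the same edge. Either way it yields a nonempty closed
  reduced walk, hence a circuit.\<close>

lemma alternating_prod_notin_estab:
  assumes tree: "graph_tree \<Gamma> arev"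
    and alt: "alternating (\<lambda>s. vstab s - estab) s xs" and ne: "xs \<noteq> []"
  shows "list_prod G xs \<notin> estab"
proof
  assume e: "list_prod G xs \<in> estab"
  let ?w = "word_walk s xs"
  obtain t where t: "awalk (pt (\<not> s)) ?w (\<phi>V (list_prod G xs) (pt t))"
    "last ?w = \<phi>E (list_prod G xs) (ed t)" "successively (\<lambda>a b. b \<noteq> arev a) ?w"
    using word_walk_properties[OF alt] by blast
  have last: "last ?w = ed t"
    using e t(2) stabilizer_ed[of t True] by (auto simp: stabilizer_def)
  obtain x xs' where xs: "xs = x # xs'" using ne by (cases xs) auto
  \<comment> \<open>A nonempty word has a walk of at least two arcs, so something remains after the
    last arc is removed.\<close>
  have w: "?w = butlast ?w @ [ed t]" "butlast ?w \<noteq> []"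
    using last hd_word_walk[of s xs] hd_word_walk[of "\<not> s" xs']
    by (metis append_butlast_last_id) (use hd_word_walk[of "\<not> s" xs'] in \<open>simp add: xs\<close>)
  have aw: "awalk (pt (\<not> s)) (butlast ?w @ [ed t]) (\<phi>V (list_prod G xs) (pt t))"
    using t(1) w(1) by simp
  have red: "successively (\<lambda>a b. b \<noteq> arev a) (butlast ?w)"
    using t(3) w(1) by (metis successively_append_iff)
  have "\<exists>p. awalk (pt (\<not> s)) p (pt (\<not> s)) \<and> p \<noteq> [] \<and> successively (\<lambda>a b. b \<noteq> arev a) p"
  \<comment> \<open>If the last arc equals the first, removing it leaves a walk that ends at the
    starting point. If it is the reverse of the first, the whole walk is already closed.\<close>
  proof (cases "t = s")
    case True
    then have "awalk (pt (\<not> s)) (butlast ?w) (pt (\<not> s))"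
      using aw by (auto simp: awalk_Cons_iff)
    then show ?thesis using w red by blast
  next
    case False
    then have "t = (\<not> s)" by auto
    moreover have "\<phi>V (list_prod G xs) (pt t) = pt t"
      using aw by (auto simp: awalk_simps)
    ultimately have "awalk (pt (\<not> s)) ?w (pt (\<not> s))" using t(1) by simp
    moreover have "?w \<noteq> []" using hd_word_walk by blast
    ultimately show ?thesis using t(3) by blast
  qed
  then show False
    using tree closed_reduced_walk_imp_circuit unfolding graph_tree_def by blast
qed

text \<open>The translates of \<open>pt True\<close> and \<open>pt False\<close> by \<open>I\<close> are closed under adjacency.\<close>

lemma generated_by_vstabs:
  assumes tree: "graph_tree \<Gamma> arev" and I: "subgroup I G" and sub: "\<And>s. vstab s \<subseteq> I"
  shows "I = carrier G"
proof
  interpret I: subgroup I G by fact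
  show "I \<subseteq> carrier G" by (rule I.subset)
  define V where "V = {\<phi>V k (pt s) |k s. k \<in> I}"
  have "v \<in> V" if "awalk u p v" "u \<in> V" for u p v
    using that
  proof (induction p arbitrary: u)
    case Nil
    then show ?case by (simp add: awalk_Nil_iff)
  next
    case (Cons a p)
    then have a: "a \<in> arcs \<Gamma>" "u = tail \<Gamma> a" "awalk (head \<Gamma> a) p v"
      by (auto simp: awalk_Cons_iff)
    obtain k s where k: "k \<in> I" "u = \<phi>V k (pt s)" using Cons.prems by (auto simp: V_def)
    obtain g t where g: "g \<in> carrier G" "a = \<phi>E g (ed t)" using arc_orbits a(1) by blast
    have kc: "k \<in> carrier G" using k by auto
    have eq: "\<phi>V g (pt (\<not> t)) = \<phi>V k (pt s)" using a k g by (simp add: tail_action)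
    \<comment> \<open>An element that maps one base vertex to another must fix it, since the two lie
      in different orbits. So \<open>inv k \<otimes> g\<close> is in \<open>vstab s\<close>, hence
      in \<open>I\<close>, and \<open>g\<close> follows.\<close>
    have "\<phi>V (inv k \<otimes> g) (pt (\<not> t)) = pt s"
      using eq kc g vertex_action.orbit_sym_aux[OF kc pt_verts HOL.refl, of s]
      by (simp add: vertex_action.composition_rule)
    moreover from this have "s = (\<not> t)"
      using orbits_disjoint[of "inv k \<otimes> g" "\<not> t"] kc g by (cases s; cases t) auto
    ultimately have "inv k \<otimes> g \<in> I"
      using kc g by (intro subsetD[OF sub[of s]]) (auto simp: stabilizer_def)
    then have "k \<otimes> (inv k \<otimes> g) \<in> I" using k by blast
    then have "g \<in> I" using kc g by (simp add: m_assoc[symmetric])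
    then have "head \<Gamma> a \<in> V" using g by (auto simp: V_def head_action)
    then show ?case using Cons.IH a(3) by blast
  qed
  moreover have base: "pt s \<in> V" for s
  proof -
    have "\<phi>V \<one> (pt s) = pt s"
      using vertex_action.stabilizer_one_closed[OF pt_verts, of s] by (simp add: stabilizer_def)
    then show ?thesis
      unfolding V_def by (intro CollectI exI[of _ \<one>] exI[of _ s]) simp
  qed
  moreover have "\<exists>p. awalk (pt True) p v" if "v \<in> verts \<Gamma>" for v
  proof -
    \<comment> \<open>Connectedness is stated for the symmetric closure; as every arc has a reverse,
      reachability there is reachability in \<open>\<Gamma>\<close>.\<close>
    have "pt True \<rightarrow>\<^sup>*\<^bsub>mk_symmetric \<Gamma>\<^esub> v"
      using tree that by (auto simp: graph_tree_def connected_def strongly_connected_def)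
    then show ?thesis
      using reachable_mk_symmetric_eq[OF sym_arcs] by (simp add: reachable_awalk)
  qed
  ultimately have V: "v \<in> V" if "v \<in> verts \<Gamma>" for v using that by blast
  show "carrier G \<subseteq> I"
  proof
    fix g assume g: "g \<in> carrier G"
    \<comment> \<open>The same division for an arbitrary \<open>g\<close>: it differs from an
      element of \<open>I\<close> by an element fixing \<open>pt True\<close>.\<close>
    then have "\<phi>V g (pt True) \<in> V" using V vertex_action.element_image pt_verts by blast
    then obtain k s where k: "k \<in> I" "\<phi>V g (pt True) = \<phi>V k (pt s)" by (auto simp: V_def)
    have kc: "k \<in> carrier G" using k by auto
    have "\<phi>V (inv k \<otimes> g) (pt True) = pt s"
      using k kc g vertex_action.orbit_sym_aux[OF kc pt_verts HOL.refl, of s]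
      by (simp add: vertex_action.composition_rule)
    moreover from this have s
      using orbits_disjoint[of "inv k \<otimes> g" True] kc g by (cases s) auto
    ultimately have "inv k \<otimes> g \<in> I"
      using kc g by (intro subsetD[OF sub[of s]]) (auto simp: stabilizer_def)
    then have "k \<otimes> (inv k \<otimes> g) \<in> I" using k by blast
    then show "g \<in> I" using kc g by (simp add: m_assoc[symmetric])
  qed
qed

end


section \<open>Amalgams of normalized subgroups\<close>

text \<open>The algebraic half, free of trees: \<open>H\<close> normalizes both factors and the
  amalgamated subgroup, so conjugation can pass to the amalgam.\<close>

locale normalized_amalgam = group G
  for G :: "('g, 'm) monoid_scheme" (structure) +
  fixes X :: "bool \<Rightarrow> 'g set" and C H :: "'g set"
  assumes X_subgroup: "subgroup (X s) G" and C_subgroup: "subgroup C G" and H_subgroup: "subgroup H G"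
    and C_subset: "C \<subseteq> X s"
    and X_conj: "h \<in> H \<Longrightarrow> x \<in> X s \<Longrightarrow> h \<otimes> x \<otimes> inv h \<in> X s"
    and C_conj: "h \<in> H \<Longrightarrow> c \<in> C \<Longrightarrow> h \<otimes> c \<otimes> inv h \<in> C"
begin

sublocale amalgam_data "G\<lparr>carrier := X True\<rparr>" "G\<lparr>carrier := X False\<rparr>" "G\<lparr>carrier := C\<rparr>"
  "\<lambda>x. x" "\<lambda>x. x"
  using C_subset[of True] C_subset[of False]
  by (auto intro!: amalgam_data.intro amalgam_data_axioms.intro subgroup_imp_group
      X_subgroup C_subgroup simp: hom_def)

lemma X_closed: "x \<in> X s \<Longrightarrow> x \<in> carrier G"
  using subgroup.subset[OF X_subgroup] by blast

lemma C_closed: "c \<in> C \<Longrightarrow> c \<in> carrier G"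
  using subgroup.subset[OF C_subgroup] by blast

lemma H_closed: "h \<in> H \<Longrightarrow> h \<in> carrier G"
  using subgroup.subset[OF H_subgroup] by blast

lemma X_mult: "x \<in> X s \<Longrightarrow> y \<in> X s \<Longrightarrow> x \<otimes> y \<in> X s"
  by (rule subgroup.m_closed[OF X_subgroup])

definition inj_factor :: "bool \<Rightarrow> 'g \<Rightarrow> ('g + 'g) list set" where
  "inj_factor s = (if s then inl else inr)"

lemma inj_factor_closed: "x \<in> X s \<Longrightarrow> inj_factor s x \<in> carrier M"
  using inl_hom inr_hom by (cases s) (auto simp: inj_factor_def hom_def)

lemma inj_factor_mult:
  "x \<in> X s \<Longrightarrow> y \<in> X s \<Longrightarrow> inj_factor s (x \<otimes> y) = inj_factor s x \<otimes>\<^bsub>M\<^esub> inj_factor s y"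
  using inl_hom inr_hom by (cases s) (auto simp: inj_factor_def hom_def)

lemma inj_factor_one: "inj_factor s \<one> = \<one>\<^bsub>M\<^esub>"
  using hom_one[OF inl_hom A.is_group group_amalgam] hom_one[OF inr_hom B.is_group group_amalgam]
  by (cases s) (auto simp: inj_factor_def)

lemma inj_factor_amalgamated: "c \<in> C \<Longrightarrow> inj_factor s c = inj_factor t c"
  using inl_inr by (cases s; cases t) (auto simp: inj_factor_def)

lemma ex_hom_from_amalgam:
  assumes K: "group K" and f: "\<And>s. f s \<in> hom (G\<lparr>carrier := X s\<rparr>) K"
    and eq: "\<And>c. c \<in> C \<Longrightarrow> f True c = f False c"
  obtains h where "h \<in> hom M K" "\<And>s x. x \<in> X s \<Longrightarrow> h (inj_factor s x) = f s x"
proof -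
  obtain h where "h \<in> hom M K" "\<forall>x \<in> X True. h (inl x) = f True x"
    "\<forall>x \<in> X False. h (inr x) = f False x"
    using universal_property[OF K f[of True] f[of False]] eq by auto
  then show thesis
    by (intro that[of h]) (auto simp: inj_factor_def split: if_splits)
qed

lemma hom_from_amalgam_unique:
  assumes "group K" "h \<in> hom M K" "h' \<in> hom M K"
    and "\<And>s x. x \<in> X s \<Longrightarrow> h (inj_factor s x) = h' (inj_factor s x)" and "m \<in> carrier M"
  shows "h m = h' m"
  using assms(4)[of _ True] assms(4)[of _ False]
  by (intro hom_unique[OF assms(1-3) _ _ assms(5)]) (auto simp: inj_factor_def)

section \<open>The action of \<open>H\<close> on the amalgam by conjugation\<close>

lemma conj_mult:
  assumes "h \<in> carrier G" "x \<in> carrier G" "y \<in> carrier G"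
  shows "h \<otimes> (x \<otimes> y) \<otimes> inv h = (h \<otimes> x \<otimes> inv h) \<otimes> (h \<otimes> y \<otimes> inv h)"
  using assms by (simp add: m_assoc inv_solve_left)

lemma conjugation_action_iff:
  "conjugation_action G (X True) (X False) C H \<theta> \<longleftrightarrow>
     \<theta> \<in> hom (G\<lparr>carrier := H\<rparr>) (AutoGroup M) \<and>
     (\<forall>h \<in> H. \<forall>s. \<forall>x \<in> X s. \<theta> h (inj_factor s x) = inj_factor s (h \<otimes> x \<otimes> inv h))"
  using X_conj by (auto simp: conjugation_action_def Let_def inj_factor_def all_bool_eq)

text \<open>The universal property glues conjugation by \<open>h\<close> on the two factors to an
  endomorphism \<open>t h\<close>. Uniqueness of homomorphisms from the amalgam makes
  \<open>t\<close> multiplicative with \<open>t \<one>\<close> the identity on \<open>M\<close>, so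
  \<open>t (inv h)\<close> inverts \<open>t h\<close>.\<close>

lemma ex_conjugation_action: "\<exists>\<theta>. conjugation_action G (X True) (X False) C H \<theta>"
proof -
  interpret M: group M by (rule group_amalgam)
  have "\<exists>t. t \<in> hom M M \<and> (\<forall>s. \<forall>x \<in> X s. t (inj_factor s x) = inj_factor s (h \<otimes> x \<otimes> inv h))"
    if h: "h \<in> H" for h
  proof -
    have "(\<lambda>x. inj_factor s (h \<otimes> x \<otimes> inv h)) \<in> hom (G\<lparr>carrier := X s\<rparr>) M" for s
      using h X_conj
      by (auto intro!: homI inj_factor_closed simp: conj_mult inj_factor_mult X_closed H_closed)
    \<comment> \<open>The two maps agree on \<open>C\<close>: conjugation by \<open>h\<close>
      preserves \<open>C\<close>, and there the embeddings of both factors coincide.\<close>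
    then show ?thesis
      using C_conj[OF h] inj_factor_amalgamated
      by (elim ex_hom_from_amalgam[OF group_amalgam]) (blast, metis)
  qed
  then obtain t where t: "\<And>h. h \<in> H \<Longrightarrow> t h \<in> hom M M"
    "\<And>h s x. h \<in> H \<Longrightarrow> x \<in> X s \<Longrightarrow> t h (inj_factor s x) = inj_factor s (h \<otimes> x \<otimes> inv h)"
    by metis
  have t_closed: "t h m \<in> carrier M" if "h \<in> H" "m \<in> carrier M" for h m
    using t(1) that by (auto simp: hom_def)
  have H: "\<one> \<in> H" "\<And>h. h \<in> H \<Longrightarrow> inv h \<in> H" "\<And>h h'. h \<in> H \<Longrightarrow> h' \<in> H \<Longrightarrow> h \<otimes> h' \<in> H"
    using subgroup.one_closed[OF H_subgroup] subgroup.m_inv_closed[OF H_subgroup]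
      subgroup.m_closed[OF H_subgroup] by simp_all
  have t_one: "t \<one> m = m" if "m \<in> carrier M" for m
  proof (rule hom_from_amalgam_unique[OF group_amalgam _ _ _ that,
      where h = "t \<one>" and h' = "\<lambda>m. m"])
    show "t \<one> \<in> hom M M" using H(1) by (rule t(1))
    show "t \<one> (inj_factor s x) = inj_factor s x" if "x \<in> X s" for s x
      using t(2)[OF H(1) that] X_closed[OF that] by simp
  qed (simp add: hom_def)
  have t_mult: "t (h \<otimes> h') m = t h (t h' m)" if h: "h \<in> H" "h' \<in> H" and m: "m \<in> carrier M" for h h' m
  proof -
    have "t (h \<otimes> h') m = (t h \<circ> t h') m"
    proof (rule hom_from_amalgam_unique[OF group_amalgam _ _ _ m, where h = "t (h \<otimes> h')"])
      show "t (h \<otimes> h') \<in> hom M M" using H(3)[OF h] by (rule t(1))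
      show "t h \<circ> t h' \<in> hom M M" using t(1)[OF h(2)] t(1)[OF h(1)] by (rule Group.hom_compose)
      fix s x assume x: "x \<in> X s"
      have "(h \<otimes> h') \<otimes> x \<otimes> inv (h \<otimes> h') = h \<otimes> (h' \<otimes> x \<otimes> inv h') \<otimes> inv h"
        using h x H_closed X_closed by (simp add: m_assoc inv_mult_group)
      then show "t (h \<otimes> h') (inj_factor s x) = (t h \<circ> t h') (inj_factor s x)"
        using t(2)[OF h(1) X_conj[OF h(2) x]] t(2)[OF h(2) x] t(2)[OF H(3)[OF h] x] by simp
    qed
    then show ?thesis by simp
  qed
  \<comment> \<open>Members of \<open>AutoGroup M\<close> are extensional functions, hence the
    restriction to the carrier.\<close>
  define \<theta> where "\<theta> h = restrict (t h) (carrier M)" for h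
  have bij: "bij_betw (t h) (carrier M) (carrier M)" if h: "h \<in> H" for h
  proof (rule bij_betw_byWitness[where f' = "t (inv h)"])
    show "\<forall>m \<in> carrier M. t (inv h) (t h m) = m" "\<forall>m \<in> carrier M. t h (t (inv h) m) = m"
      using h H H_closed[OF h] t_mult[of "inv h" h] t_mult[of h "inv h"] by (auto simp: t_one)
  qed (use h H t_closed in auto)
  have "\<theta> \<in> hom (G\<lparr>carrier := H\<rparr>) (AutoGroup M)"
  proof (rule homI)
    show "\<theta> h \<in> carrier (AutoGroup M)" if "h \<in> carrier (G\<lparr>carrier := H\<rparr>)" for h
    proof -
      have h: "h \<in> H" using that by simp
      have "bij_betw (\<theta> h) (carrier M) (carrier M)"
        using bij[OF h] by (simp add: \<theta>_def cong: bij_betw_cong)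
      moreover have "\<theta> h \<in> hom M M"
        using t(1)[OF h] t_closed[OF h] by (auto simp: \<theta>_def hom_def)
      ultimately show ?thesis
        by (simp add: AutoGroup_def auto_def Bij_def \<theta>_def)
    qed
    then have Bij: "\<theta> h \<in> Bij (carrier M)" if "h \<in> H" for h
      using that by (auto simp: AutoGroup_def auto_def)
    show "\<theta> (h \<otimes>\<^bsub>G\<lparr>carrier := H\<rparr>\<^esub> h') = \<theta> h \<otimes>\<^bsub>AutoGroup M\<^esub> \<theta> h'"
      if "h \<in> carrier (G\<lparr>carrier := H\<rparr>)" "h' \<in> carrier (G\<lparr>carrier := H\<rparr>)" for h h'
      using that Bij t_closed t_mult
      by (auto simp: AutoGroup_def BijGroup_def \<theta>_def compose_def restrict_def fun_eq_iff)
  qed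
  moreover have "\<theta> h (inj_factor s x) = inj_factor s (h \<otimes> x \<otimes> inv h)" if "h \<in> H" "x \<in> X s" for h s x
    using that t(2) by (simp add: \<theta>_def inj_factor_closed)
  ultimately show ?thesis by (auto simp: conjugation_action_iff)
qed

section \<open>Normal forms in the amalgam\<close>

primrec alternating_value :: "bool \<Rightarrow> 'g list \<Rightarrow> ('g + 'g) list set" where
  "alternating_value s [] = \<one>\<^bsub>M\<^esub>"
| "alternating_value s (x # xs) = inj_factor s x \<otimes>\<^bsub>M\<^esub> alternating_value (\<not> s) xs"

abbreviation "reduced \<equiv> alternating (\<lambda>s. X s - C)"

lemma alternating_value_closed: "reduced s xs \<Longrightarrow> alternating_value s xs \<in> carrier M"
proof (induction xs arbitrary: s)
  case Nil
  then show ?case using group_amalgam group.is_monoid monoid.one_closed by fastforce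
next
  case (Cons x xs)
  then show ?case
    using group_amalgam by (simp add: inj_factor_closed group.is_monoid monoid.m_closed)
qed

text \<open>No coset representatives are chosen, so an element may have several forms; the argument
  uses only existence.\<close>

definition normal_forms :: "('g + 'g) list set set" where
  "normal_forms =
     {inj_factor s c \<otimes>\<^bsub>M\<^esub> alternating_value s xs |c s xs. c \<in> C \<and> reduced s xs}"

text \<open>A letter in \<open>C\<close> becomes the leading coefficient on the other side; any
  other letter extends the reduced word, with coefficient \<open>\<one>\<close>.\<close>

lemma normal_formsI:
  assumes "x \<in> X s" "reduced (\<not> s) xs"
  shows "inj_factor s x \<otimes>\<^bsub>M\<^esub> alternating_value (\<not> s) xs \<in> normal_forms"
proof (cases "x \<in> C")
  case True
  then show ?thesis
    using assms inj_factor_amalgamated[of x s "\<not> s"] unfolding normal_forms_def by auto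
next
  case False
  interpret M: group M by (rule group_amalgam)
  have "inj_factor s x \<otimes>\<^bsub>M\<^esub> alternating_value (\<not> s) xs =
      inj_factor s \<one> \<otimes>\<^bsub>M\<^esub> alternating_value s (x # xs)"
    using assms by (simp add: inj_factor_one inj_factor_closed alternating_value_closed)
  moreover have "\<one> \<in> C" using subgroup.one_closed[OF C_subgroup] .
  moreover have "reduced s (x # xs)" using assms False by simp
  ultimately show ?thesis unfolding normal_forms_def by blast
qed

text \<open>The coefficient is absorbed into \<open>a\<close>. If the word starts on the same side,
  its first letter is absorbed too. What is left is one letter before a reduced word on the other
  side, as in \<open>normal_formsI\<close>.\<close>

lemma normal_forms_mult:
  assumes a: "a \<in> X t" and m: "m \<in> normal_forms"
  shows "inj_factor t a \<otimes>\<^bsub>M\<^esub> m \<in> normal_forms"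
proof -
  interpret M: group M by (rule group_amalgam)
  obtain s c xs where "c \<in> C" "reduced s xs" "m = inj_factor s c \<otimes>\<^bsub>M\<^esub> alternating_value s xs"
    using m by (auto simp: normal_forms_def)
  then have c: "c \<in> C" "reduced s xs" "m = inj_factor t c \<otimes>\<^bsub>M\<^esub> alternating_value s xs"
    using inj_factor_amalgamated[of c s t] by simp_all
  have ct: "c \<in> X t" using c C_subset by blast
  have eq: "inj_factor t a \<otimes>\<^bsub>M\<^esub> m = inj_factor t (a \<otimes> c) \<otimes>\<^bsub>M\<^esub> alternating_value s xs"
    using a ct c
    by (simp add: inj_factor_mult inj_factor_closed alternating_value_closed M.m_assoc)
  consider "s = (\<not> t)" | "s = t" "xs = []" | x xs' where "s = t" "xs = x # xs'"
    by (cases xs) auto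
  then show ?thesis
  proof cases
    case 1
    then show ?thesis using normal_formsI[of "a \<otimes> c" t xs] a ct c eq X_mult by simp
  next
    case 2
    then show ?thesis using normal_formsI[of "a \<otimes> c" t "[]"] a ct eq X_mult by simp
  next
    case (3 x xs')
    then have x: "x \<in> X t" "reduced (\<not> t) xs'" using c by auto
    have "inj_factor t a \<otimes>\<^bsub>M\<^esub> m = inj_factor t (a \<otimes> c \<otimes> x) \<otimes>\<^bsub>M\<^esub> alternating_value (\<not> t) xs'"
      using 3 a ct x X_mult[OF a ct] eq
      by (simp add: inj_factor_mult[of "a \<otimes> c"] inj_factor_closed alternating_value_closed M.m_assoc)
    then show ?thesis using normal_formsI[of "a \<otimes> c \<otimes> x" t xs'] a ct x X_mult by simp
  qed
qed

text \<open>The normal forms contain the unit and are stable under left multiplication by letters,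
  and letters generate the amalgam.\<close>

lemma carrier_normal_forms: "m \<in> carrier M \<Longrightarrow> m \<in> normal_forms"
proof -
  interpret M: group M by (rule group_amalgam)
  have "cls w \<in> normal_forms" if "w \<in> W" for w
    using that
  proof (induction w)
    case Nil
    have "inj_factor True \<one> \<otimes>\<^bsub>M\<^esub> alternating_value True [] = cls []"
      using inj_factor_one by (simp, simp add: amalgam_def)
    moreover have "\<one> \<in> C" using subgroup.one_closed[OF C_subgroup] .
    ultimately show ?case
      unfolding normal_forms_def
      by (intro CollectI exI[of _ \<one>] exI[of _ True] exI[of _ "[]"]) simp
  next
    case (Cons z w)
    then have w: "[z] \<in> W" "w \<in> W" by (auto simp: amalgam_words_def)
    obtain s a where z: "a \<in> X s" "cls [z] = inj_factor s a"
      using w(1) by (fastforce simp: amalgam_words_def inj_factor_def amalgam_inl_def amalgam_inr_def)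
    have "inj_factor s a \<otimes>\<^bsub>M\<^esub> cls w = cls (z # w)" using mult_cls[OF w] z(2) by simp
    then show ?case using normal_forms_mult[OF z(1) Cons.IH[OF w(2)]] by simp
  qed
  then show "m \<in> normal_forms" if "m \<in> carrier M"
    using that by (auto simp: amalgam_def)
qed

text \<open>Criterion to be fed by the tree: \<open>gen\<close> makes the map to \<open>G\<close>
  surjective, while \<open>free\<close> and \<open>CH\<close> make its kernel trivial.\<close>

theorem iso_semidirect_product:
  assumes \<theta>: "conjugation_action G (X True) (X False) C H \<theta>"
    and gen: "\<And>I. subgroup I G \<Longrightarrow> (\<And>s. X s \<subseteq> I) \<Longrightarrow> H \<subseteq> I \<Longrightarrow> I = carrier G"
    and free: "\<And>s xs c h. reduced s xs \<Longrightarrow> xs \<noteq> [] \<Longrightarrow> c \<in> C \<Longrightarrow> h \<in> H \<Longrightarrow>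
      c \<otimes> list_prod G xs \<otimes> h \<noteq> \<one>"
    and CH: "C \<inter> H = {\<one>}"
  shows "G \<cong> semidirect_product M (G\<lparr>carrier := H\<rparr>) \<theta>"
proof -
  interpret M: group M by (rule group_amalgam)
  let ?S = "semidirect_product M (G\<lparr>carrier := H\<rparr>) \<theta>"
  have \<theta>_hom: "\<theta> \<in> hom (G\<lparr>carrier := H\<rparr>) (AutoGroup M)"
    and \<theta>_factor: "\<And>h s x. h \<in> H \<Longrightarrow> x \<in> X s \<Longrightarrow>
      \<theta> h (inj_factor s x) = inj_factor s (h \<otimes> x \<otimes> inv h)"
    using \<theta> unfolding conjugation_action_iff by auto
  have \<theta>_end: "\<theta> h \<in> hom M M" if "h \<in> H" for h
  proof -
    have "\<theta> h \<in> carrier (AutoGroup M)" using \<theta>_hom that by (auto simp: hom_def)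
    then show ?thesis by (simp add: AutoGroup_def auto_def)
  qed
  interpret S: group ?S
    by (rule group_semidirect_product[OF group_amalgam subgroup_imp_group[OF H_subgroup] \<theta>_hom])
  obtain f where f: "f \<in> hom M G" "\<And>s x. x \<in> X s \<Longrightarrow> f (inj_factor s x) = x"
    by (rule ex_hom_from_amalgam[OF is_group, of "\<lambda>s x. x"]) (auto simp: hom_def X_closed)
  interpret f: group_hom M G f
    by (simp add: group_hom_def group_hom_axioms_def f(1) group_amalgam)
  \<comment> \<open>Both sides are homomorphisms in \<open>m\<close> that agree on the factors. This
    equivariance makes \<open>F\<close> multiplicative.\<close>
  have f_conj: "f (\<theta> h m) = h \<otimes> f m \<otimes> inv h" if h: "h \<in> H" and m: "m \<in> carrier M" for h m
  proof -
    have "(f \<circ> \<theta> h) m = h \<otimes> f m \<otimes> inv h"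
    proof (rule hom_from_amalgam_unique[OF is_group _ _ _ m,
        where h = "f \<circ> \<theta> h" and h' = "\<lambda>m. h \<otimes> f m \<otimes> inv h"])
      show "f \<circ> \<theta> h \<in> hom M G" using \<theta>_end[OF h] f(1) by (rule Group.hom_compose)
      show "(\<lambda>m. h \<otimes> f m \<otimes> inv h) \<in> hom M G"
        using H_closed[OF h] by (auto intro!: homI simp: conj_mult)
      show "(f \<circ> \<theta> h) (inj_factor s x) = h \<otimes> f (inj_factor s x) \<otimes> inv h" if "x \<in> X s" for s x
        using that h X_conj \<theta>_factor f(2) by simp
    qed
    then show ?thesis by simp
  qed
  define F where "F = (\<lambda>(m, h). f m \<otimes> h)"
  have carrier_S: "carrier ?S = carrier M \<times> H" by (simp add: semidirect_product_def)
  have F_hom: "F \<in> hom ?S G"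
  proof (rule homI)
    fix p assume "p \<in> carrier ?S"
    then obtain m h where p: "p = (m, h)" "m \<in> carrier M" "h \<in> H" by (auto simp: carrier_S)
    then show "F p \<in> carrier G" by (simp add: F_def H_closed)
    fix q assume "q \<in> carrier ?S"
    then obtain m' h' where q: "q = (m', h')" "m' \<in> carrier M" "h' \<in> H" by (auto simp: carrier_S)
    have "\<theta> h m' \<in> carrier M" using \<theta>_end p q by (auto simp: hom_def)
    then have "F (p \<otimes>\<^bsub>?S\<^esub> q) = f m \<otimes> (h \<otimes> f m' \<otimes> inv h) \<otimes> (h \<otimes> h')"
      using p q f_conj by (simp add: F_def semidirect_product_def)
    also have "\<dots> = f m \<otimes> h \<otimes> (f m' \<otimes> h')"
      using p q H_closed m_assoc[of "inv h" h h'] by (simp add: m_assoc)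
    finally show "F (p \<otimes>\<^bsub>?S\<^esub> q) = F p \<otimes> F q" using p q by (simp add: F_def)
  qed
  interpret F: group_hom ?S G F
    by (simp add: group_hom_def group_hom_axioms_def F_hom S.is_group is_group)
  have "F ` carrier ?S = carrier G"
  proof (rule gen)
    show "subgroup (F ` carrier ?S) G" by (rule F.img_is_subgroup)
    show "X s \<subseteq> F ` carrier ?S" for s
    proof
      fix x assume "x \<in> X s"
      then show "x \<in> F ` carrier ?S"
        using subgroup.one_closed[OF H_subgroup]
        by (intro image_eqI[of _ F "(inj_factor s x, \<one>)"])
          (simp_all add: F_def f(2) X_closed carrier_S inj_factor_closed)
    qed
    show "H \<subseteq> F ` carrier ?S"
    proof
      fix h assume "h \<in> H"
      then show "h \<in> F ` carrier ?S"
        by (intro image_eqI[of _ F "(\<one>\<^bsub>M\<^esub>, h)"]) (simp_all add: F_def H_closed carrier_S)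
    qed
  qed
  moreover have "inj_on F (carrier ?S)"
  proof -
    have "p = \<one>\<^bsub>?S\<^esub>" if p: "p \<in> carrier ?S" and F: "F p = \<one>" for p
    proof -
      obtain m h where mh: "p = (m, h)" "m \<in> carrier M" "h \<in> H" using p by (auto simp: carrier_S)
      \<comment> \<open>In a normal form of a kernel element, \<open>free\<close> forces the word to
        be empty; then \<open>c\<close> is \<open>inv h\<close>, which lies in
        \<open>C \<inter> H\<close>.\<close>
      obtain c s xs where c: "c \<in> C" "reduced s xs"
        and m: "m = inj_factor s c \<otimes>\<^bsub>M\<^esub> alternating_value s xs"
        using carrier_normal_forms[OF mh(2)] by (auto simp: normal_forms_def)
      have cs: "c \<in> X s" using c C_subset by blast
      have "f (alternating_value s xs) = list_prod G xs" using c(2)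
        by (induction xs arbitrary: s)
          (auto simp: f(2) inj_factor_closed alternating_value_closed)
      then have eq: "c \<otimes> list_prod G xs \<otimes> h = \<one>"
        using F cs c by (simp add: F_def mh(1) m f(2) inj_factor_closed alternating_value_closed)
      then have xs: "xs = []" using free c mh(3) by blast
      then have ch: "c \<otimes> h = \<one>" using eq c C_closed by simp
      then have "c = inv h" using C_closed H_closed c mh(3) by (metis inv_equality)
      then have "c \<in> C \<inter> H" using c subgroup.m_inv_closed[OF H_subgroup mh(3)] by simp
      then have "c = \<one>" using CH by blast
      then have "h = \<one>" "m = \<one>\<^bsub>M\<^esub>"
        using ch H_closed[OF mh(3)] by (simp_all add: m xs inj_factor_one)
      then show ?thesis by (simp add: mh(1) semidirect_product_def)
    qed
    then show ?thesis
      by (auto simp: F.inj_iff_trivial_ker kernel_def)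
  qed
  ultimately have "F \<in> iso ?S G" using F_hom by (simp add: iso_def bij_betw_def)
  then show ?thesis by (rule S.iso_sym[OF is_isoI])
qed

end

section \<open>Groups acting on a tree with a segment as quotient\<close>

text \<open>The lifted edge \<open>y\<close> may point to either end, so \<open>ed s\<close> selects
  the orientation with the required head. Bijectivity of the lift on arcs makes every arc a
  translate of \<open>y\<close> or \<open>arev y\<close>.\<close>

lemma segment_actionI:
  fixes G :: "('g, 'm) monoid_scheme" and \<Gamma> \<Lambda> :: "('v, 'e) pre_digraph"
  assumes "graph_action G \<Gamma> arev \<phi>V \<phi>E"
    and seg: "segment (quotient_graph G \<Gamma> \<phi>V \<phi>E) (quotient_arev G \<Gamma> arev \<phi>E)"
    and lift: "is_lift G \<Gamma> arev \<phi>V \<phi>E \<Lambda>"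
    and \<Lambda>: "verts \<Lambda> = {P, Q}" "arcs \<Lambda> = {y, arev y}"
  shows "segment_action G \<Gamma> arev \<phi>V \<phi>E (\<lambda>s. if s then P else Q)
    (\<lambda>s. if head \<Gamma> y = (if s then P else Q) then y else arev y)"
proof -
  interpret graph_action G \<Gamma> arev \<phi>V \<phi>E by fact
  let ?Q = "quotient_graph G \<Gamma> \<phi>V \<phi>E"
  have sub: "subgraph \<Lambda> \<Gamma>" and bV: "bij_betw (orbit G \<phi>V) {P, Q} (verts ?Q)"
    and bE: "bij_betw (orbit G \<phi>E) {y, arev y} (arcs ?Q)"
    using lift \<Lambda> by (simp_all add: is_lift_def)
  have y: "y \<in> arcs \<Gamma>" and PQ: "P \<in> verts \<Gamma>" "Q \<in> verts \<Gamma>"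
    using sub \<Lambda> by (auto simp: subgraph_def)
  interpret \<Lambda>: wf_digraph \<Lambda> using sub by (simp add: subgraph_def)
  have ends: "head \<Gamma> y \<in> {P, Q}" "tail \<Gamma> y \<in> {P, Q}"
    using \<Lambda>.head_in_verts[of y] \<Lambda>.tail_in_verts[of y] sub \<Lambda>
    by (auto simp: subgraph_def compatible_def)
  obtain u v a where seg': "u \<noteq> v" "verts ?Q = {u, v}" "arcs ?Q = {a, quotient_arev G \<Gamma> arev \<phi>E a}"
    "tail ?Q a = u" "head ?Q a = v" "bidirected_digraph ?Q (quotient_arev G \<Gamma> arev \<phi>E)"
    using seg unfolding segment_def by (elim conjE exE, intro that)
  interpret Q: bidirected_digraph ?Q "quotient_arev G \<Gamma> arev \<phi>E" by (fact seg'(6))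
  \<comment> \<open>A segment has no loops. Applied to the orbit of \<open>y\<close>, this puts the
    ends of \<open>y\<close> in different orbits, so they are \<open>P\<close> and \<open>Q\<close>
    in some order.\<close>
  have ne: "tail ?Q X \<noteq> head ?Q X" if "X \<in> arcs ?Q" for X
    using that seg' Q.tail_arev[of a] Q.head_arev[of a] by auto
  have "orbit G \<phi>E y \<in> arcs ?Q" using bE by (auto simp: bij_betw_def)
  from ne[OF this] have "orbit G \<phi>V (tail \<Gamma> y) \<noteq> orbit G \<phi>V (head \<Gamma> y)"
    using y by (simp add: quotient_graph_def tail_image_orbit head_image_orbit)
  then have ht: "tail \<Gamma> y \<noteq> head \<Gamma> y"
    and orb: "orbit G \<phi>V P \<noteq> orbit G \<phi>V Q" using ends by (metis, metis insertE singletonD)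
  then have neq: "P \<noteq> Q" by auto
  have disj: "\<phi>V g P \<noteq> Q" "\<phi>V g Q \<noteq> P" if g: "g \<in> carrier G" for g
  proof -
    have "orbit G \<phi>V (\<phi>V g v) = orbit G \<phi>V v" if v: "v \<in> verts \<Gamma>" for v
    proof -
      have "\<phi>V g v \<in> orbit G \<phi>V v" using g by (auto simp: orbit_def)
      moreover have w: "\<phi>V g v \<in> verts \<Gamma>" using vertex_action.element_image[OF g v] by blast
      then have "\<phi>V g v \<in> orbit G \<phi>V (\<phi>V g v)" by (rule vertex_action.orbit_refl)
      ultimately show ?thesis
        using vertex_action.disjoint_union[of "orbit G \<phi>V v" "orbit G \<phi>V (\<phi>V g v)"] v w
        by (auto simp: orbits_def)
    qed
    with PQ orb show "\<phi>V g P \<noteq> Q" "\<phi>V g Q \<noteq> P" by metis+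
  qed
  have arc: "\<exists>g \<in> carrier G. a = \<phi>E g y \<or> a = \<phi>E g (arev y)" if a: "a \<in> arcs \<Gamma>" for a
  proof -
    have "orbit G \<phi>E a \<in> arcs ?Q" using a by (auto simp: quotient_graph_def orbits_def)
    then have "orbit G \<phi>E a \<in> {orbit G \<phi>E y, orbit G \<phi>E (arev y)}"
      using bE by (auto simp: bij_betw_def)
    moreover have "a \<in> orbit G \<phi>E a" using a by (rule arc_action.orbit_refl)
    ultimately show ?thesis by (auto simp: orbit_def)
  qed
  show ?thesis
  proof unfold_locales
    fix s
    let ?pt = "\<lambda>s. if s then P else Q"
    let ?ed = "\<lambda>s. if head \<Gamma> y = ?pt s then y else arev y"
    show "?ed s \<in> arcs \<Gamma>" using y by simp
    show "head \<Gamma> (?ed s) = ?pt s" using y ends ht by auto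
    show "arev (?ed s) = ?ed (\<not> s)" using ends neq by auto
    show "\<phi>V g (?pt s) \<noteq> ?pt (\<not> s)" if "g \<in> carrier G" for g using disj[OF that] by simp
    show "\<exists>g \<in> carrier G. \<exists>s. a = \<phi>E g (?ed s)" if a: "a \<in> arcs \<Gamma>" for a
    proof -
      obtain g z where g: "g \<in> carrier G" "a = \<phi>E g z" "z = y \<or> z = arev y"
        using arc[OF a] by blast
      have "\<exists>s. z = ?ed s" using g(3) ends neq by (auto simp: ex_bool_eq)
      then obtain s where "z = ?ed s" ..
      with g show ?thesis by (intro bexI[of _ g] exI[of _ s]) simp_all
    qed
  qed
qed

section \<open>Internal semidirect products with a common complement\<close>

lemma (in group) internal_semidirect_conj:
  assumes "internal_semidirect G S K H" "h \<in> H" "k \<in> K"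
  shows "h \<otimes> k \<otimes> inv h \<in> K"
proof -
  have S: "subgroup S G" "subgroup K G" "subgroup H G" "K \<lhd> G\<lparr>carrier := S\<rparr>" "S = K <#> H"
    using assms(1) by (auto simp: internal_semidirect_def)
  have "\<one> \<otimes> h \<in> K <#> H"
    using assms(2) subgroup.one_closed[OF S(2)] unfolding set_mult_def by blast
  then have "h \<in> S" using S assms(2) subgroup.mem_carrier[OF S(3)] by simp
  then show ?thesis
    using normal.inv_op_closed2[OF S(4), of h k] assms(3) S(1) by (simp add: m_inv_consistent)
qed

lemma (in group) internal_semidirect_subset:
  assumes "internal_semidirect G S K H"
  shows "K \<subseteq> S" "H \<subseteq> S"
proof -
  have S: "subgroup K G" "subgroup H G" "S = K <#> H"
    using assms by (auto simp: internal_semidirect_def)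
  show "K \<subseteq> S"
  proof
    fix k assume "k \<in> K"
    then have "k \<otimes> \<one> \<in> S" using S subgroup.one_closed[OF S(2)] unfolding set_mult_def by blast
    then show "k \<in> S" using \<open>k \<in> K\<close> subgroup.mem_carrier[OF S(1)] by simp
  qed
  show "H \<subseteq> S"
  proof
    fix h assume "h \<in> H"
    then have "\<one> \<otimes> h \<in> S" using S subgroup.one_closed[OF S(1)] unfolding set_mult_def by blast
    then show "h \<in> S" using \<open>h \<in> H\<close> subgroup.mem_carrier[OF S(2)] by simp
  qed
qed

text \<open>If \<open>l \<otimes> h\<close> lies in \<open>K\<close> with \<open>l\<close> in
  \<open>L\<close>, then \<open>h\<close> lies in \<open>K \<inter> H\<close> and is trivial. This
  shows that letters of a factor outside \<open>Gy\<close> move the edge.\<close>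

lemma (in group) internal_semidirect_Int:
  assumes K: "internal_semidirect G S K H" and L: "internal_semidirect G T L H" and "L \<subseteq> K"
  shows "K \<inter> T = L"
proof
  show "L \<subseteq> K \<inter> T" using \<open>L \<subseteq> K\<close> internal_semidirect_subset(1)[OF L] by blast
  show "K \<inter> T \<subseteq> L"
  proof
    have sub: "subgroup K G" "subgroup L G" "subgroup H G" and KH: "K \<inter> H = {\<one>}"
      and T: "T = L <#> H"
      using K L by (auto simp: internal_semidirect_def)
    fix x assume "x \<in> K \<inter> T"
    then obtain l h where x: "x \<in> K" "x = l \<otimes> h" "l \<in> L" "h \<in> H"
      by (auto simp: T set_mult_def)
    have c: "l \<in> carrier G" "h \<in> carrier G"
      using x subgroup.mem_carrier[OF sub(2)] subgroup.mem_carrier[OF sub(3)] by auto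
    have "inv l \<otimes> x \<in> K"
      using x \<open>L \<subseteq> K\<close> subgroup.m_closed[OF sub(1)] subgroup.m_inv_closed[OF sub(1)] by blast
    moreover have "inv l \<otimes> x = h" using x c m_assoc[of "inv l" l h] by simp
    ultimately have "h = \<one>" using KH x by auto
    then show "x \<in> L" using x c by simp
  qed
qed

theorem theorem2:
  fixes G :: "('g, 'm) monoid_scheme"
    and \<Gamma> \<Lambda> :: "('v, 'e) pre_digraph"
    and arev :: "'e \<Rightarrow> 'e"
    and \<phi>V :: "'g \<Rightarrow> 'v \<Rightarrow> 'v" and \<phi>E :: "'g \<Rightarrow> 'e \<Rightarrow> 'e"
    and P Q :: 'v and y :: 'e
    and GP GQ Gy H :: "'g set"
  assumes "group G"
    and "graph_tree \<Gamma> arev"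
    and "graph_action G \<Gamma> arev \<phi>V \<phi>E"
    and "without_inversion G \<Gamma> arev \<phi>E"
    and "segment (quotient_graph G \<Gamma> \<phi>V \<phi>E) (quotient_arev G \<Gamma> arev \<phi>E)"
    and "is_lift G \<Gamma> arev \<phi>V \<phi>E \<Lambda>"
    and "verts \<Lambda> = {P, Q}" and "arcs \<Lambda> = {y, arev y}"
    and "subgroup GP G" and "subgroup GQ G" and "subgroup Gy G" and "subgroup H G"
    and "Gy \<subseteq> GP" and "Gy \<subseteq> GQ"
    and "internal_semidirect G (stabilizer G \<phi>V P) GP H"
    and "internal_semidirect G (stabilizer G \<phi>V Q) GQ H"
    and "internal_semidirect G (stabilizer G \<phi>E y) Gy H"
  shows "\<exists>\<theta>. conjugation_action G GP GQ Gy H \<theta> \<and>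
    G \<cong> semidirect_product (subgroup_amalgam G GP GQ Gy) (G\<lparr>carrier := H\<rparr>) \<theta>"
proof -
  interpret group G by fact
  define pt where "pt = (\<lambda>s. if s then P else Q)"
  define ed where "ed = (\<lambda>s. if head \<Gamma> y = pt s then y else arev y)"
  define X where "X = (\<lambda>s. if s then GP else GQ)"
  have pt: "pt True = P" "pt False = Q" and X: "X True = GP" "X False = GQ"
    by (simp_all add: pt_def X_def)
  interpret segment_action G \<Gamma> arev \<phi>V \<phi>E pt ed
    unfolding ed_def pt_def by (rule segment_actionI) fact+
  have sdV: "internal_semidirect G (vstab s) (X s) H" for s
    using assms(15,16) pt X by (cases s) simp_all
  \<comment> \<open>Whichever way \<open>y\<close> points, it is one of the two orientations, so
    \<open>estab\<close> is its stabilizer.\<close>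
  have "ed True = y \<or> ed False = y"
    using arev_ed[of True] by (auto simp: ed_def)
  then have "estab = stabilizer G \<phi>E y"
    using stabilizer_ed[of True False] by auto
  then have sdE: "internal_semidirect G estab Gy H" using assms(17) by simp
  have sub: "Gy \<subseteq> X s" for s using assms(13,14) X by (cases s) simp_all
  interpret normalized_amalgam G X Gy H
  proof (intro normalized_amalgam.intro normalized_amalgam_axioms.intro)
    show "group G" by fact
    show "subgroup (X s) G" for s using assms(9,10) X by (cases s) simp_all
    show "subgroup Gy G" "subgroup H G" by fact+
    show "Gy \<subseteq> X s" for s by (rule sub)
    show "h \<otimes>\<^bsub>G\<^esub> x \<otimes>\<^bsub>G\<^esub> inv\<^bsub>G\<^esub> h \<in> X s" if "h \<in> H" "x \<in> X s" for h x s
      by (rule internal_semidirect_conj[OF sdV that])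
    show "h \<otimes>\<^bsub>G\<^esub> c \<otimes>\<^bsub>G\<^esub> inv\<^bsub>G\<^esub> h \<in> Gy" if "h \<in> H" "c \<in> Gy" for h c
      by (rule internal_semidirect_conj[OF sdE that])
  qed
  obtain \<theta> where \<theta>: "conjugation_action G (X True) (X False) Gy H \<theta>"
    using ex_conjugation_action ..
  have "G \<cong> semidirect_product (subgroup_amalgam G (X True) (X False) Gy) (G\<lparr>carrier := H\<rparr>) \<theta>"
  proof (rule iso_semidirect_product[OF \<theta>])
    show "I = carrier G" if I: "subgroup I G" "\<And>s. X s \<subseteq> I" "H \<subseteq> I" for I
    proof (rule generated_by_vstabs[OF assms(2) I(1)])
      fix s
      have "vstab s = X s <#>\<^bsub>G\<^esub> H" using sdV[of s] by (simp only: internal_semidirect_def)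
      moreover have "k \<otimes>\<^bsub>G\<^esub> h \<in> I" if "k \<in> X s" "h \<in> H" for k h
        by (rule subgroup.m_closed[OF I(1) subsetD[OF I(2) that(1)] subsetD[OF I(3) that(2)]])
      ultimately show "vstab s \<subseteq> I" by (auto simp only: set_mult_def)
    qed
    show "Gy \<inter> H = {\<one>\<^bsub>G\<^esub>}" using sdE by (simp add: internal_semidirect_def)
    fix s xs c h
    assume red: "reduced s xs" and ne: "xs \<noteq> []" and ch: "c \<in> Gy" "h \<in> H"
    have "X s - Gy \<subseteq> vstab s - estab" for s
      using internal_semidirect_Int[OF sdV sdE sub, of s]
        internal_semidirect_subset(1)[OF sdV, of s] by blast
    then have "alternating (\<lambda>s. vstab s - estab) s xs" by (rule alternating_mono[OF red])
    then have notin: "list_prod G xs \<notin> estab"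
      by (rule alternating_prod_notin_estab[OF assms(2) _ ne])
    show "c \<otimes>\<^bsub>G\<^esub> list_prod G xs \<otimes>\<^bsub>G\<^esub> h \<noteq> \<one>\<^bsub>G\<^esub>"
    proof
      assume eq: "c \<otimes>\<^bsub>G\<^esub> list_prod G xs \<otimes>\<^bsub>G\<^esub> h = \<one>\<^bsub>G\<^esub>"
      have p: "list_prod G xs \<in> carrier G"
        using alternating_set[OF red] X_closed by (intro list_prod_closed) auto
      have c: "c \<in> carrier G" "h \<in> carrier G" using ch C_closed H_closed by auto
      \<comment> \<open>Solving for the word expresses it through \<open>c\<close> and
        \<open>h\<close>, both of which fix the edge.\<close>
      have "list_prod G xs = inv\<^bsub>G\<^esub> c \<otimes>\<^bsub>G\<^esub> (c \<otimes>\<^bsub>G\<^esub> list_prod G xs \<otimes>\<^bsub>G\<^esub> h) \<otimes>\<^bsub>G\<^esub> inv\<^bsub>G\<^esub> h"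
        using p c m_assoc[of "inv\<^bsub>G\<^esub> c" c "list_prod G xs"] by (simp add: m_assoc)
      also have "\<dots> = inv\<^bsub>G\<^esub> c \<otimes>\<^bsub>G\<^esub> inv\<^bsub>G\<^esub> h" using eq c by simp
      also have "\<dots> \<in> estab"
      proof -
        have estab: "subgroup estab G" using sdE unfolding internal_semidirect_def by (rule conjunct1)
        have "c \<in> estab" "h \<in> estab" using ch internal_semidirect_subset[OF sdE] by blast+
        then show ?thesis
          by (intro subgroup.m_closed[OF estab] subgroup.m_inv_closed[OF estab])
      qed
      finally show False using notin by blast
    qed
  qed
  then show ?thesis using \<theta> unfolding X by blast
qed

end
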